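(* Let $d\geqslant1$, let $\mathbb{T}^d=\mathbb{R}^d/\mathbb{Z}^d$, let $\lambda>0$ be a constant, and let $l=l(v):T\mathbb{T}^d\to\mathbb{R}$ be a Tonelli Lagrangian independent of $x\in\mathbb{T}^d$. Let $L(x,v,u)=l(v)+\lambda u$ for $(x,v,u)\in T\mathbb{T}^d\times\mathbb{R}$, and let $\{T_t\}_{t\geqslant0}$ be the contact-type Lax-Oleinik semigroup on $C^0(\mathbb{T}^d)$ associated with $L$. Then for any compact subset $V\subset C^0(\mathbb{T}^d)$, there holds $g(V)\leqslant\lambda$. Moreover, $h_{\rm top}(T_t)=\lambda$.
   Context: The torus carries its standard flat metric and $T\mathbb{T}^d=\mathbb{T}^d\times\mathbb{R}^d$. That $l=l(v)$ is a Tonelli Lagrangian means: $l$ is of class $C^2$, $l_{vv}(v)>0$ (positive definite) for all $v$, and there exist a super-linear continuous function $\theta_0:[0,+\infty)\to[0,+\infty)$ (i.e. $\theta_0(r)/r\to+\infty$ as $r\to+\infty$) and a constant $c_0\geqslant0$ with $l(v)\geqslant\theta_0(|v|)-c_0$ for all $v$. $C^0(\mathbb{T}^d)=C(\mathbb{T}^d)$ is the space of continuous real-valued functions with the maximum norm. Lax-Oleinik semigroup: with $M=\mathbb{T}^d$, $T_0=\mathrm{id}$, and for $t>0$, $\phi\in C(M)$, $x\in M$, $$(T_t\phi)(x)=\inf_{\xi\in\mathcal{A}_{t,x}}\Big\{\phi(\xi(0))+\int_0^tL(\xi(s),\dot\xi(s),u_\xi(s))\,ds\Big\},$$ where $\mathcal{A}_{t,x}$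 is the set of absolutely continuous arcs $\xi:[0,t]\to M$ with $\xi(t)=x$, and $u_\xi:[0,t]\to\mathbb{R}$ is the unique (absolutely continuous) solution of the Carathéodory equation $\dot u_\xi(s)=L(\xi(s),\dot\xi(s),u_\xi(s))$, $u_\xi(0)=\phi(\xi(0))$ (arcs for which $s\mapsto L(\xi(s),\dot\xi(s),0)$ is not integrable contribute $+\infty$). $\{T_t\}_{t\geqslant 0}$ is a continuous semigroup on $C(M)$. Topological entropy: for a continuous semigroup $\{T_t\}_{t\geqslant0}$ on a complete metric space $(X,d)$ (here $X=C^0(\mathbb{T}^d)$ with the metric induced by the maximum norm), let $B(x,t,\varepsilon)=\{y\in X: d(T_s(y),T_s(x))<\varepsilon \text{ for all } s\in[0,t]\}$. For $K\subset X$ compact, let $g_t(\varepsilon,K)$ be the smallest cardinality of a set $E\subset X$ with $K\subset\bigcup_{x\in E}B(x,t,\varepsilon)$. Define $$g(K)=\lim_{\varepsilon\to0^+}\limsup_{t\to\infty}\frac1t\log g_t(\varepsilon,K),\qquad h_{\rm top}(T_t)=\sup_{K}g(K),$$ the supremum being over all compact subsets $K$ of $X$. *)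

theory Defs
  imports "HOL-Analysis.Analysis"
begin

quotient_type (overloaded) 'n torus = "real ^ 'n::finite" /
  "\<lambda>x y :: real ^ 'n::finite. \<forall>i. x $ i - y $ i \<in> \<int>"
  morphisms torus_class torus_proj
proof (rule equivpI)
  show "reflp (\<lambda>x y :: real ^ 'n. \<forall>i. x $ i - y $ i \<in> \<int>)"
    by (simp add: reflp_def)
  show "symp (\<lambda>x y :: real ^ 'n. \<forall>i. x $ i - y $ i \<in> \<int>)"
  proof (rule sympI, rule allI)
    fix x y :: "real ^ 'n" and i
    assume "\<forall>i. x $ i - y $ i \<in> \<int>"
    then have "- (x $ i - y $ i) \<in> \<int>"
      by (intro Ints_minus) auto
    then show "y $ i - x $ i \<in> \<int>" by simp
  qed
  show "transp (\<lambda>x y :: real ^ 'n. \<forall>i. x $ i - y $ i \<in> \<int>)"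
  proof (rule transpI, rule allI)
    fix x y z :: "real ^ 'n" and i
    assume "\<forall>i. x $ i - y $ i \<in> \<int>" "\<forall>i. y $ i - z $ i \<in> \<int>"
    then have "(x $ i - y $ i) + (y $ i - z $ i) \<in> \<int>"
      by (intro Ints_add) auto
    then show "x $ i - z $ i \<in> \<int>" by simp
  qed
qed

lemma torus_proj_eq_iff:
  "torus_proj x = torus_proj y \<longleftrightarrow> (\<forall>i. x $ i - y $ i \<in> \<int>)"
  by (rule torus.abs_eq_iff)

lemma torus_proj_surj: "\<exists>x. torus_proj x = p"
  by (rule torus.abs_induct[of "\<lambda>p. \<exists>x. torus_proj x = p"]) blast

text \<open>The distance of the flat metric is the quotient distance.\<close>

definition torus_dist :: "'n::finite torus \<Rightarrow> 'n torus \<Rightarrow> real" where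
  "torus_dist p q = Inf {norm (x - y) | x y. torus_proj x = p \<and> torus_proj y = q}"

lemma torus_dist_bdd: "bdd_below {norm (x - y) | x y. torus_proj x = p \<and> torus_proj y = q}"
  by (rule bdd_belowI[of _ 0]) auto

lemma torus_dist_le: "torus_dist (torus_proj x) (torus_proj y) \<le> norm (x - y)"
  unfolding torus_dist_def by (rule cInf_lower[OF _ torus_dist_bdd]) auto

lemma torus_dist_ne: "{norm (x - y) | x y. torus_proj x = p \<and> torus_proj y = q} \<noteq> {}"
  using torus_proj_surj[of p] torus_proj_surj[of q] by auto

lemma torus_dist_nonneg: "0 \<le> torus_dist p q"
  unfolding torus_dist_def by (rule cInf_greatest[OF torus_dist_ne]) auto

lemma torus_dist_approx:
  assumes "torus_dist p q < e"
  obtains x y where "torus_proj x = p" "torus_proj y = q" "norm (x - y) < e"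
  using cInf_lessD[OF torus_dist_ne assms[unfolded torus_dist_def]] by blast

instantiation torus :: (finite) metric_space
begin

definition dist_torus :: "'a torus \<Rightarrow> 'a torus \<Rightarrow> real" where
  "dist_torus = torus_dist"

definition uniformity_torus :: "('a torus \<times> 'a torus) filter" where
  "uniformity_torus = (INF e\<in>{0 <..}. principal {(x, y). dist x y < e})"

definition open_torus :: "'a torus set \<Rightarrow> bool" where
  "open_torus U \<longleftrightarrow> (\<forall>x\<in>U. eventually (\<lambda>(x', y). x' = x \<longrightarrow> y \<in> U) uniformity)"

instance
proof
  fix p q r :: "'a torus"
  show "dist p q = 0 \<longleftrightarrow> p = q"
  proof
    assume "p = q"
    then obtain x where "torus_proj x = p" "torus_proj x = q"
      using torus_proj_surj by metis
    then have "torus_dist p q \<le> 0"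
      using torus_dist_le[of x x] by simp
    then show "dist p q = 0"
      using torus_dist_nonneg[of p q] by (simp add: dist_torus_def)
  next
    assume d0: "dist p q = 0"
    obtain x y where xy: "torus_proj x = p" "torus_proj y = q"
      using torus_proj_surj by metis
    have "x $ i - y $ i \<in> \<int>" for i
    proof (rule ccontr)
      define a where "a = x $ i - y $ i"
      assume "x $ i - y $ i \<notin> \<int>"
      then have f: "0 < frac a" "frac a < 1"
        by (auto simp: a_def frac_gt_0_iff frac_lt_1)
      then have "torus_dist p q < min (frac a) (1 - frac a)"
        using d0 by (simp add: dist_torus_def)
      then obtain x' y' where xy': "torus_proj x' = p" "torus_proj y' = q"
        "norm (x' - y') < min (frac a) (1 - frac a)"
        by (rule torus_dist_approx)
      have "x' $ i - x $ i \<in> \<int>" "y' $ i - y $ i \<in> \<int>"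
        using xy xy' by (metis torus_proj_eq_iff)+
      then have "(x' $ i - x $ i) - (y' $ i - y $ i) \<in> \<int>"
        by (rule Ints_diff)
      then obtain k :: int where k: "(x' $ i - x $ i) - (y' $ i - y $ i) = of_int k"
        by (auto elim: Ints_cases)
      have "\<bar>(x' - y') $ i\<bar> < min (frac a) (1 - frac a)"
        using component_le_norm_cart[of "x' - y'" i] xy'(3) by linarith
      moreover have "(x' - y') $ i = a + of_int k"
        using k by (simp add: a_def)
      ultimately have lt: "\<bar>frac a + of_int (\<lfloor>a\<rfloor> + k)\<bar> < min (frac a) (1 - frac a)"
        by (simp add: frac_def algebra_simps)
      show False
      proof (cases "\<lfloor>a\<rfloor> + k \<ge> 0")
        case True
        then have "(of_int (\<lfloor>a\<rfloor> + k) :: real) \<ge> 0" by linarith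
        then show False using lt f by linarith
      next
        case False
        then have "\<lfloor>a\<rfloor> + k \<le> -1" by linarith
        then have "(of_int (\<lfloor>a\<rfloor> + k) :: real) \<le> -1" by linarith
        then show False using lt f by linarith
      qed
    qed
    then show "p = q" using xy torus_proj_eq_iff by metis
  qed
  show "dist p q \<le> dist p r + dist q r"
  proof (rule field_le_epsilon)
    fix e :: real assume "e > 0"
    then have "torus_dist p r < torus_dist p r + e / 2" "torus_dist q r < torus_dist q r + e / 2"
      by auto
    then obtain x z y z' where
      a: "torus_proj x = p" "torus_proj z = r" "norm (x - z) < torus_dist p r + e / 2" and
      b: "torus_proj y = q" "torus_proj z' = r" "norm (y - z') < torus_dist q r + e / 2"
      using torus_dist_approx by metis
    have "torus_proj (y + (z - z')) = q"
      using a(2) b by (metis (no_types, lifting) add_diff_cancel_left' torus_proj_eq_iff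
          vector_add_component vector_minus_component)
    then have "torus_dist p q \<le> norm (x - (y + (z - z')))"
      using a(1) torus_dist_le by metis
    also have "\<dots> = norm ((x - z) - (y - z'))"
      by (simp add: algebra_simps)
    also have "\<dots> \<le> norm (x - z) + norm (y - z')"
      by (rule norm_triangle_ineq4)
    finally show "dist p q \<le> dist p r + dist q r + e"
      using a(3) b(3) by (simp add: dist_torus_def)
  qed
qed (simp_all only: uniformity_torus_def open_torus_def)

end

lemma compact_UNIV_torus: "compact (UNIV :: 'n::finite torus set)"
proof -
  have "continuous_on (cbox 0 1) (torus_proj :: real ^ 'n \<Rightarrow> 'n torus)"
    unfolding continuous_on_iff
    by (metis dist_norm dist_torus_def order_le_less_trans torus_dist_le)
  then have "compact ((torus_proj :: real ^ 'n \<Rightarrow> 'n torus) ` cbox 0 1)"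
    by (rule compact_continuous_image) (rule compact_cbox)
  moreover have "p \<in> torus_proj ` (cbox 0 1 :: (real ^ 'n) set)" for p :: "'n torus"
  proof -
    obtain x where x: "torus_proj x = p" using torus_proj_surj by metis
    define y :: "real ^ 'n" where "y = (\<chi> i. frac (x $ i))"
    have "torus_proj y = torus_proj x"
      unfolding torus_proj_eq_iff by (simp add: y_def frac_def)
    moreover have "y \<in> cbox 0 1"
      by (simp add: y_def mem_box_cart frac_ge_0 less_imp_le[OF frac_lt_1])
    ultimately show ?thesis using x by (metis image_eqI)
  qed
  then have "torus_proj ` (cbox 0 1 :: (real ^ 'n) set) = UNIV" by auto
  ultimately show ?thesis by simp
qed

text \<open>
  Hence the Banach space \<open>'n torus \<Rightarrow>\<^sub>C real\<close> of bounded continuous functions with the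
  supremum norm is \<open>C\<^sup>0\<close> of the torus.
\<close>

lemma continuous_torus_bcontfun:
  fixes f :: "'n::finite torus \<Rightarrow> real"
  assumes "continuous_on UNIV f"
  shows "f \<in> bcontfun"
  using assms compact_imp_bounded[OF compact_continuous_image[OF assms compact_UNIV_torus]]
  by (simp add: bcontfun_def)

lift_definition torus_exp :: "'n::finite torus \<Rightarrow> real ^ 'n \<Rightarrow> 'n torus" is "\<lambda>x v. x + v"
  by simp

definition abs_continuous_arc :: "real \<Rightarrow> real \<Rightarrow> (real \<Rightarrow> 'a::metric_space) \<Rightarrow> bool" where
  "abs_continuous_arc a b f \<longleftrightarrow>
    (\<forall>\<epsilon>>0. \<exists>\<delta>>0. \<forall>(n::nat) (\<alpha> :: nat \<Rightarrow> real) (\<beta> :: nat \<Rightarrow> real).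
      (\<forall>i<n. a \<le> \<alpha> i \<and> \<alpha> i \<le> \<beta> i \<and> \<beta> i \<le> b) \<longrightarrow>
      disjoint_family_on (\<lambda>i. {\<alpha> i<..<\<beta> i}) {..<n} \<longrightarrow>
      (\<Sum>i<n. \<beta> i - \<alpha> i) < \<delta> \<longrightarrow>
      (\<Sum>i<n. dist (f (\<alpha> i)) (f (\<beta> i))) < \<epsilon>)"

text \<open>
  \<open>\<xi>\<close> has velocity \<open>v\<close> at \<open>s\<close>, where the tangent space of the torus at \<open>\<xi> s\<close> is identified
  with \<open>real ^ 'n\<close>: the arc agrees with the geodesic \<open>exp (\<xi> s) ((r - s) v)\<close> up to \<open>o(r - s)\<close>.
\<close>

definition has_torus_velocity ::
    "(real \<Rightarrow> 'n::finite torus) \<Rightarrow> real ^ 'n \<Rightarrow> real \<Rightarrow> real set \<Rightarrow> bool" where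
  "has_torus_velocity \<xi> v s S \<longleftrightarrow>
    ((\<lambda>r. dist (\<xi> r) (torus_exp (\<xi> s) ((r - s) *\<^sub>R v)) / \<bar>r - s\<bar>) \<longlongrightarrow> 0) (at s within S)"

text \<open>
  In \<open>admissible_arc\<close>, \<open>\<xi>'\<close> is a representative of the velocity of \<open>\<xi>\<close>, which is
  determined up to null sets.
\<close>

definition admissible_arc ::
    "real \<Rightarrow> 'n::finite torus \<Rightarrow> (real \<Rightarrow> 'n torus) \<Rightarrow> (real \<Rightarrow> real ^ 'n) \<Rightarrow> bool" where
  "admissible_arc t x \<xi> \<xi>' \<longleftrightarrow>
    abs_continuous_arc 0 t \<xi> \<and> \<xi> t = x \<and>
    (AE s in lebesgue_on {0..t}. has_torus_velocity \<xi> (\<xi>' s) s {0..t})"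

definition tonelli :: "(real ^ 'n::finite \<Rightarrow> real) \<Rightarrow> bool" where
  "tonelli l \<longleftrightarrow>
    (\<exists>(Dl :: real ^ 'n \<Rightarrow> real ^ 'n) (D2l :: real ^ 'n \<Rightarrow> real ^ 'n ^ 'n).
      (\<forall>v. (l has_derivative (\<lambda>h. Dl v \<bullet> h)) (at v)) \<and>
      (\<forall>v. (Dl has_derivative (\<lambda>h. D2l v *v h)) (at v)) \<and>
      continuous_on UNIV D2l \<and>
      (\<forall>v h. h \<noteq> 0 \<longrightarrow> h \<bullet> (D2l v *v h) > 0)) \<and>
    (\<exists>(\<theta>\<^sub>0 :: real \<Rightarrow> real) c\<^sub>0.
      continuous_on {0..} \<theta>\<^sub>0 \<and> (\<forall>r\<ge>0. \<theta>\<^sub>0 r \<ge> 0) \<and>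
      filterlim (\<lambda>r. \<theta>\<^sub>0 r / r) at_top at_top \<and>
      c\<^sub>0 \<ge> 0 \<and> (\<forall>v. l v \<ge> \<theta>\<^sub>0 (norm v) - c\<^sub>0))"

definition caratheodory_solution ::
    "('n::finite torus \<Rightarrow> real ^ 'n \<Rightarrow> real \<Rightarrow> real) \<Rightarrow> real \<Rightarrow> (real \<Rightarrow> 'n torus) \<Rightarrow>
     (real \<Rightarrow> real ^ 'n) \<Rightarrow> real \<Rightarrow> (real \<Rightarrow> real) \<Rightarrow> bool" where
  "caratheodory_solution L t \<xi> \<xi>' u\<^sub>0 u \<longleftrightarrow>
    abs_continuous_arc 0 t u \<and> u 0 = u\<^sub>0 \<and>
    (AE s in lebesgue_on {0..t}. (u has_real_derivative L (\<xi> s) (\<xi>' s) (u s)) (at s within {0..t}))"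

text \<open>
  Arcs along which \<open>L(\<xi>, \<xi>', 0)\<close> is not integrable have infinite action and are left out of
  the infimum.
\<close>

definition lax_oleinik_value ::
    "('n::finite torus \<Rightarrow> real ^ 'n \<Rightarrow> real \<Rightarrow> real) \<Rightarrow> real \<Rightarrow> ('n torus \<Rightarrow>\<^sub>C real) \<Rightarrow>
     'n torus \<Rightarrow> real" where
  "lax_oleinik_value L t \<phi> x =
    Inf {apply_bcontfun \<phi> (\<xi> 0) + (LINT s|lebesgue_on {0..t}. L (\<xi> s) (\<xi>' s) (u s)) | \<xi> \<xi>' u.
      admissible_arc t x \<xi> \<xi>' \<and>
      integrable (lebesgue_on {0..t}) (\<lambda>s. L (\<xi> s) (\<xi>' s) 0) \<and>
      caratheodory_solution L t \<xi> \<xi>' (apply_bcontfun \<phi> (\<xi> 0)) u}"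

definition lax_oleinik ::
    "('n::finite torus \<Rightarrow> real ^ 'n \<Rightarrow> real \<Rightarrow> real) \<Rightarrow> real \<Rightarrow> ('n torus \<Rightarrow>\<^sub>C real) \<Rightarrow>
     ('n torus \<Rightarrow>\<^sub>C real)" where
  "lax_oleinik L t \<phi> = (if t > 0 then Bcontfun (lax_oleinik_value L t \<phi>) else \<phi>)"

definition bowen_ball :: "(real \<Rightarrow> 'a::metric_space \<Rightarrow> 'a) \<Rightarrow> 'a \<Rightarrow> real \<Rightarrow> real \<Rightarrow> 'a set" where
  "bowen_ball T x t \<epsilon> = {y. \<forall>s\<in>{0..t}. dist (T s y) (T s x) < \<epsilon>}"

definition spanning_number ::
    "(real \<Rightarrow> 'a::metric_space \<Rightarrow> 'a) \<Rightarrow> real \<Rightarrow> real \<Rightarrow> 'a set \<Rightarrow> enat" where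
  "spanning_number T t \<epsilon> K = Inf {enat (card E) | E. finite E \<and> K \<subseteq> (\<Union>x\<in>E. bowen_ball T x t \<epsilon>)}"

fun ln_enat :: "enat \<Rightarrow> ereal" where
  "ln_enat (enat n) = (if n = 0 then -\<infinity> else ereal (ln (real n)))"
| "ln_enat \<infinity> = \<infinity>"

definition compact_entropy :: "(real \<Rightarrow> 'a::metric_space \<Rightarrow> 'a) \<Rightarrow> 'a set \<Rightarrow> ereal" where
  "compact_entropy T K =
    Lim (at_right 0) (\<lambda>\<epsilon>. Limsup at_top (\<lambda>t. ereal (1 / t) * ln_enat (spanning_number T t \<epsilon> K)))"

definition topological_entropy :: "(real \<Rightarrow> 'a::metric_space \<Rightarrow> 'a) \<Rightarrow> ereal" where
  "topological_entropy T = (SUP K\<in>{K. compact K}. compact_entropy T K)"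

end

theory Submission
  imports Defs "HOL-Real_Asymp.Real_Asymp"
begin

text \<open>
  Along an arc \<open>\<xi>\<close> the equation \<open>u' = l (\<xi>') + lam u\<close> is linear and can be solved. Up to an additive
  constant that depends on \<open>t\<close> only, the value of the semigroup at \<open>x\<close> is therefore the infimum over
  \<open>y\<close> of \<open>exp (lam t) \<phi> y + h\<^sub>t y x\<close>, where \<open>h\<^sub>t y x\<close> is the least discounted action
  \<open>\<integral> exp (lam (t - s)) (l (\<xi>' s) + c) ds\<close> of an arc from \<open>y\<close> to \<open>x\<close> on \<open>[0, t]\<close>
  (\<open>lax_oleinik_value_eq\<close>). The constant \<open>c\<close> is chosen such that \<open>l + c\<close> dominates the speed.

  The lower bound comes from the constant functions: the semigroup multiplies their distances by
  \<open>exp (lam t)\<close>, so the compact set of constants in \<open>[0, 1]\<close> has entropy at least \<open>lam\<close>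
  (\<open>spanning_rate_const_ge\<close>).

  For the upper bound it does not suffice that the semigroup expands distances at most by
  \<open>exp (lam t)\<close>, since a compact set of continuous functions may be infinite-dimensional. The
  decisive fact is that the costs \<open>h\<^sub>t y x\<close> for \<open>t \<ge> 1\<close> are uniformly continuous in \<open>y\<close>, with a modulus
  independent of \<open>t\<close>: an arc with displaced source can be repaired in a short step near its end, where the
  discount factor is of order 1 (\<open>transport_cost_move_source\<close>). Two consequences follow. Up to a
  small error, \<open>\<phi>\<close> influences its image only through its minima over a finite number of small
  balls, a number that does not grow with \<open>t\<close>. And at time \<open>s\<close> only those balls matter whose
  minimum exceeds the global minimum by at most \<open>K exp (- lam s)\<close>. It is therefore enough to know the global
  minimum up to an error of order \<open>exp (- lam t)\<close>, and the excess over each ball up to a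
  fixed relative error (\<open>lax_oleinik_close_if_profile_close\<close>). There are of the order of
  \<open>exp (lam t)\<close> possibilities for the former and only polynomially many in \<open>t\<close> for the latter
  (\<open>spanning_number_upper\<close>), which gives the growth rate \<open>lam\<close> whatever the dimension of the torus.
\<close>

section \<open>Absolutely continuous functions and the gauge integral\<close>

lemma abs_continuous_arcI:
  assumes "\<And>e. e > 0 \<Longrightarrow> \<exists>\<delta>>0. \<forall>(n::nat) (\<alpha> :: nat \<Rightarrow> real) \<beta>.
      (\<forall>i<n. a \<le> \<alpha> i \<and> \<alpha> i \<le> \<beta> i \<and> \<beta> i \<le> b) \<longrightarrow>
      disjoint_family_on (\<lambda>i. {\<alpha> i<..<\<beta> i}) {..<n} \<longrightarrow>
      (\<Sum>i<n. \<beta> i - \<alpha> i) < \<delta> \<longrightarrow> (\<Sum>i<n. dist (f (\<alpha> i)) (f (\<beta> i))) < e"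
  shows "abs_continuous_arc a b f"
  using assms unfolding abs_continuous_arc_def by blast

lemma abs_continuous_arcD:
  assumes "abs_continuous_arc a b f" "e > 0"
  obtains \<delta> where "\<delta> > 0"
    "\<And>(n::nat) \<alpha> \<beta>. (\<And>i. i < n \<Longrightarrow> a \<le> \<alpha> i \<and> \<alpha> i \<le> \<beta> i \<and> \<beta> i \<le> b) \<Longrightarrow>
      disjoint_family_on (\<lambda>i. {\<alpha> i<..<\<beta> i}) {..<n} \<Longrightarrow>
      (\<Sum>i<n. \<beta> i - \<alpha> i) < \<delta> \<Longrightarrow> (\<Sum>i<n. dist (f (\<alpha> i)) (f (\<beta> i))) < e"
  using assms unfolding abs_continuous_arc_def by blast

text \<open>
  This comparison covers Lipschitz arcs, translates of arcs, distances to a fixed point and products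
  with Lipschitz functions at one stroke.
\<close>

lemma abs_continuous_arc_dominated:
  assumes f: "abs_continuous_arc a b f"
    and dom: "\<And>s r. a \<le> s \<Longrightarrow> s \<le> r \<Longrightarrow> r \<le> b \<Longrightarrow> dist (g s) (g r) \<le> K * (dist (f s) (f r) + (r - s))"
  shows "abs_continuous_arc a b g"
proof (rule abs_continuous_arcI)
  fix e :: real assume "e > 0"
  define k where "k = \<bar>K\<bar> + 1"
  have k: "k > 0" "K \<le> k" by (auto simp: k_def)
  have "e / (2 * k) > 0" using \<open>e > 0\<close> k by simp
  from abs_continuous_arcD[OF f this] obtain d where d: "d > 0"
    "\<And>(n::nat) \<alpha> \<beta>. (\<And>i. i < n \<Longrightarrow> a \<le> \<alpha> i \<and> \<alpha> i \<le> \<beta> i \<and> \<beta> i \<le> b) \<Longrightarrow>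
      disjoint_family_on (\<lambda>i. {\<alpha> i<..<\<beta> i}) {..<n} \<Longrightarrow>
      (\<Sum>i<n. \<beta> i - \<alpha> i) < d \<Longrightarrow> (\<Sum>i<n. dist (f (\<alpha> i)) (f (\<beta> i))) < e / (2 * k)"
    by blast
  show "\<exists>\<delta>>0. \<forall>(n::nat) (\<alpha> :: nat \<Rightarrow> real) \<beta>.
      (\<forall>i<n. a \<le> \<alpha> i \<and> \<alpha> i \<le> \<beta> i \<and> \<beta> i \<le> b) \<longrightarrow>
      disjoint_family_on (\<lambda>i. {\<alpha> i<..<\<beta> i}) {..<n} \<longrightarrow>
      (\<Sum>i<n. \<beta> i - \<alpha> i) < \<delta> \<longrightarrow> (\<Sum>i<n. dist (g (\<alpha> i)) (g (\<beta> i))) < e"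
  proof (intro exI[of _ "min d (e / (2 * k))"] conjI allI impI)
    show "0 < min d (e / (2 * k))" using d k \<open>e > 0\<close> by simp
    fix n :: nat and \<alpha> \<beta> :: "nat \<Rightarrow> real"
    assume ab: "\<forall>i<n. a \<le> \<alpha> i \<and> \<alpha> i \<le> \<beta> i \<and> \<beta> i \<le> b"
      and disj: "disjoint_family_on (\<lambda>i. {\<alpha> i<..<\<beta> i}) {..<n}"
      and small: "(\<Sum>i<n. \<beta> i - \<alpha> i) < min d (e / (2 * k))"
    have 1: "(\<Sum>i<n. dist (f (\<alpha> i)) (f (\<beta> i))) < e / (2 * k)"
      using d(2)[of n \<alpha> \<beta>] ab disj small by auto
    have "(\<Sum>i<n. dist (g (\<alpha> i)) (g (\<beta> i))) \<le> (\<Sum>i<n. k * (dist (f (\<alpha> i)) (f (\<beta> i)) + (\<beta> i - \<alpha> i)))"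
    proof (rule sum_mono)
      fix i assume "i \<in> {..<n}"
      then have i: "a \<le> \<alpha> i" "\<alpha> i \<le> \<beta> i" "\<beta> i \<le> b" using ab by auto
      have "dist (g (\<alpha> i)) (g (\<beta> i)) \<le> K * (dist (f (\<alpha> i)) (f (\<beta> i)) + (\<beta> i - \<alpha> i))"
        by (rule dom[OF i])
      also have "\<dots> \<le> k * (dist (f (\<alpha> i)) (f (\<beta> i)) + (\<beta> i - \<alpha> i))"
        by (rule mult_right_mono) (use i k in auto)
      finally show "dist (g (\<alpha> i)) (g (\<beta> i)) \<le> \<dots>" .
    qed
    also have "\<dots> = k * ((\<Sum>i<n. dist (f (\<alpha> i)) (f (\<beta> i))) + (\<Sum>i<n. \<beta> i - \<alpha> i))"
      by (simp only: sum_distrib_left[symmetric] sum.distrib)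
    also have "\<dots> < k * (e / (2 * k) + e / (2 * k))"
      using 1 small k by (intro mult_strict_left_mono) auto
    also have "\<dots> = e" using k by (simp add: field_simps)
    finally show "(\<Sum>i<n. dist (g (\<alpha> i)) (g (\<beta> i))) < e" .
  qed
qed

lemma abs_continuous_arc_lipschitz:
  assumes "\<And>s r. a \<le> s \<Longrightarrow> s \<le> r \<Longrightarrow> r \<le> b \<Longrightarrow> dist (g s) (g r) \<le> K * (r - s)"
  shows "abs_continuous_arc a b g"
proof (rule abs_continuous_arc_dominated[of a b "\<lambda>_. 0::real"])
  show "abs_continuous_arc a b (\<lambda>_. 0::real)"
    unfolding abs_continuous_arc_def using zero_less_one by auto
qed (use assms in auto)

lemma abs_continuous_arc_subinterval:
  assumes "abs_continuous_arc a b f" "a \<le> c" "d \<le> b"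
  shows "abs_continuous_arc c d f"
  using assms unfolding abs_continuous_arc_def by (meson order_trans)

lemma abs_continuous_arc_imp_continuous_on:
  assumes f: "abs_continuous_arc a b f"
  shows "continuous_on {a..b} f"
  unfolding continuous_on_iff
proof (intro ballI allI impI)
  fix s e :: real assume s: "s \<in> {a..b}" and "e > 0"
  from abs_continuous_arcD[OF f \<open>e > 0\<close>] obtain d where d: "d > 0"
    "\<And>(n::nat) \<alpha> \<beta>. (\<And>i. i < n \<Longrightarrow> a \<le> \<alpha> i \<and> \<alpha> i \<le> \<beta> i \<and> \<beta> i \<le> b) \<Longrightarrow>
      disjoint_family_on (\<lambda>i. {\<alpha> i<..<\<beta> i}) {..<n} \<Longrightarrow>
      (\<Sum>i<n. \<beta> i - \<alpha> i) < d \<Longrightarrow> (\<Sum>i<n. dist (f (\<alpha> i)) (f (\<beta> i))) < e"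
    by blast
  have "dist (f (min s r)) (f (max s r)) < e" if "r \<in> {a..b}" "dist r s < d" for r
    using d(2)[of 1 "\<lambda>_. min s r" "\<lambda>_. max s r"] that s
    by (auto simp: disjoint_family_on_def dist_real_def)
  note near = this
  have "dist (f r) (f s) < e" if "r \<in> {a..b}" "dist r s < d" for r
    using near[OF that] by (cases "s \<le> r") (auto simp: dist_commute)
  then show "\<exists>d>0. \<forall>r\<in>{a..b}. dist r s < d \<longrightarrow> dist (f r) (f s) < e"
    using d(1) by blast
qed

lemma abs_continuous_arc_mult_lipschitz:
  fixes f g :: "real \<Rightarrow> real"
  assumes f: "abs_continuous_arc a b f"
    and g: "\<And>s r. a \<le> s \<Longrightarrow> s \<le> r \<Longrightarrow> r \<le> b \<Longrightarrow> \<bar>g s - g r\<bar> \<le> K * (r - s)"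
  shows "abs_continuous_arc a b (\<lambda>s. g s * f s)"
proof -
  have gac: "abs_continuous_arc a b g"
    by (rule abs_continuous_arc_lipschitz[of _ _ _ K]) (use g in \<open>auto simp: dist_real_def\<close>)
  have "\<exists>B. \<forall>s\<in>{a..b}. \<bar>f s\<bar> \<le> B"
    using compact_imp_bounded[OF compact_continuous_image[OF abs_continuous_arc_imp_continuous_on[OF f]]]
    by (simp add: bounded_iff)
  then obtain B where B: "\<And>s. s \<in> {a..b} \<Longrightarrow> \<bar>f s\<bar> \<le> B" by blast
  have "\<exists>B. \<forall>s\<in>{a..b}. \<bar>g s\<bar> \<le> B"
    using compact_imp_bounded[OF compact_continuous_image[OF abs_continuous_arc_imp_continuous_on[OF gac]]]
    by (simp add: bounded_iff)
  then obtain C where C: "\<And>s. s \<in> {a..b} \<Longrightarrow> \<bar>g s\<bar> \<le> C" by blast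
  show ?thesis
  proof (rule abs_continuous_arc_dominated[OF f])
    fix s r assume sr: "a \<le> s" "s \<le> r" "r \<le> b"
    have "g s * f s - g r * f r = g s * (f s - f r) + f r * (g s - g r)"
      by (simp add: algebra_simps)
    then have "\<bar>g s * f s - g r * f r\<bar> \<le> \<bar>g s\<bar> * \<bar>f s - f r\<bar> + \<bar>f r\<bar> * \<bar>g s - g r\<bar>"
      by (metis abs_mult abs_triangle_ineq)
    also have "\<dots> \<le> C * \<bar>f s - f r\<bar> + B * (\<bar>K\<bar> * (r - s))"
    proof (intro add_mono mult_mono)
      have "\<bar>g s - g r\<bar> \<le> K * (r - s)" by (rule g[OF sr])
      also have "\<dots> \<le> \<bar>K\<bar> * (r - s)" using sr by (intro mult_right_mono) auto
      finally show "\<bar>g s - g r\<bar> \<le> \<bar>K\<bar> * (r - s)" .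
      show "0 \<le> B" using B[of s] sr by auto
      show "0 \<le> C" using C[of s] sr by auto
    qed (use B C sr in auto)
    also have "\<dots> \<le> (C + B * \<bar>K\<bar>) * (\<bar>f s - f r\<bar> + (r - s))"
    proof -
      have "0 \<le> B" "0 \<le> C" using B[of s] C[of s] sr by auto
      then have "0 \<le> C * (r - s)" "0 \<le> B * \<bar>K\<bar> * \<bar>f s - f r\<bar>" using sr by auto
      then show ?thesis by (simp add: algebra_simps)
    qed
    finally show "dist (g s * f s) (g r * f r) \<le> (C + B * \<bar>K\<bar>) * (dist (f s) (f r) + (r - s))"
      by (simp add: dist_real_def)
  qed
qed

text \<open>
  Cutting every interval of a test family at \<open>b\<close> gives one test family on each side, of no
  larger total length; intervals that do not reach one of the sides degenerate to points there.
\<close>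

lemma abs_continuous_arc_join:
  assumes 1: "abs_continuous_arc a b f" and 2: "abs_continuous_arc b c f" and "a \<le> b" "b \<le> c"
  shows "abs_continuous_arc a c f"
proof (rule abs_continuous_arcI)
  fix e :: real assume "e > 0"
  then have "e / 2 > 0" by simp
  from abs_continuous_arcD[OF 1 this] obtain d1 where d1: "d1 > 0"
    "\<And>(n::nat) \<alpha> \<beta>. (\<And>i. i < n \<Longrightarrow> a \<le> \<alpha> i \<and> \<alpha> i \<le> \<beta> i \<and> \<beta> i \<le> b) \<Longrightarrow>
      disjoint_family_on (\<lambda>i. {\<alpha> i<..<\<beta> i}) {..<n} \<Longrightarrow>
      (\<Sum>i<n. \<beta> i - \<alpha> i) < d1 \<Longrightarrow> (\<Sum>i<n. dist (f (\<alpha> i)) (f (\<beta> i))) < e / 2" by blast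
  from abs_continuous_arcD[OF 2 \<open>e/2 > 0\<close>] obtain d2 where d2: "d2 > 0"
    "\<And>(n::nat) \<alpha> \<beta>. (\<And>i. i < n \<Longrightarrow> b \<le> \<alpha> i \<and> \<alpha> i \<le> \<beta> i \<and> \<beta> i \<le> c) \<Longrightarrow>
      disjoint_family_on (\<lambda>i. {\<alpha> i<..<\<beta> i}) {..<n} \<Longrightarrow>
      (\<Sum>i<n. \<beta> i - \<alpha> i) < d2 \<Longrightarrow> (\<Sum>i<n. dist (f (\<alpha> i)) (f (\<beta> i))) < e / 2" by blast
  show "\<exists>\<delta>>0. \<forall>(n::nat) (\<alpha> :: nat \<Rightarrow> real) \<beta>.
      (\<forall>i<n. a \<le> \<alpha> i \<and> \<alpha> i \<le> \<beta> i \<and> \<beta> i \<le> c) \<longrightarrow>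
      disjoint_family_on (\<lambda>i. {\<alpha> i<..<\<beta> i}) {..<n} \<longrightarrow>
      (\<Sum>i<n. \<beta> i - \<alpha> i) < \<delta> \<longrightarrow> (\<Sum>i<n. dist (f (\<alpha> i)) (f (\<beta> i))) < e"
  proof (intro exI[of _ "min d1 d2"] conjI allI impI)
    show "0 < min d1 d2" using d1 d2 by simp
    fix n :: nat and \<alpha> \<beta> :: "nat \<Rightarrow> real"
    assume ab: "\<forall>i<n. a \<le> \<alpha> i \<and> \<alpha> i \<le> \<beta> i \<and> \<beta> i \<le> c"
      and disj: "disjoint_family_on (\<lambda>i. {\<alpha> i<..<\<beta> i}) {..<n}"
      and small: "(\<Sum>i<n. \<beta> i - \<alpha> i) < min d1 d2"
    let ?l = "\<lambda>g i. min (g i) b" and ?r = "\<lambda>g i. max (g i) b"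
    have "(\<Sum>i<n. ?l \<beta> i - ?l \<alpha> i) \<le> (\<Sum>i<n. \<beta> i - \<alpha> i)"
      "(\<Sum>i<n. ?r \<beta> i - ?r \<alpha> i) \<le> (\<Sum>i<n. \<beta> i - \<alpha> i)"
      by (intro sum_mono; use ab in \<open>force simp: min_def max_def\<close>)+
    moreover have "disjoint_family_on (\<lambda>i. {?l \<alpha> i<..<?l \<beta> i}) {..<n}"
      "disjoint_family_on (\<lambda>i. {?r \<alpha> i<..<?r \<beta> i}) {..<n}"
      by (rule disjoint_family_on_bisimulation[OF disj], fastforce)+
    ultimately have s: "(\<Sum>i<n. dist (f (?l \<alpha> i)) (f (?l \<beta> i))) < e / 2"
      "(\<Sum>i<n. dist (f (?r \<alpha> i)) (f (?r \<beta> i))) < e / 2"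
      using small ab \<open>a \<le> b\<close> \<open>b \<le> c\<close>
      by - (rule d1(2)[of n "?l \<alpha>" "?l \<beta>"] d2(2)[of n "?r \<alpha>" "?r \<beta>"];
        (assumption | linarith | force))+
    have "(\<Sum>i<n. dist (f (\<alpha> i)) (f (\<beta> i))) \<le>
        (\<Sum>i<n. dist (f (?l \<alpha> i)) (f (?l \<beta> i)) + dist (f (?r \<alpha> i)) (f (?r \<beta> i)))"
    proof (rule sum_mono)
      fix i assume "i \<in> {..<n}"
      then have "\<alpha> i \<le> \<beta> i" using ab by auto
      then show "dist (f (\<alpha> i)) (f (\<beta> i)) \<le>
          dist (f (?l \<alpha> i)) (f (?l \<beta> i)) + dist (f (?r \<alpha> i)) (f (?r \<beta> i))"
        using dist_triangle[of "f (\<alpha> i)" "f (\<beta> i)" "f b"] by (auto simp: min_def max_def)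
    qed
    also have "\<dots> < e" using s by (simp add: sum.distrib)
    finally show "(\<Sum>i<n. dist (f (\<alpha> i)) (f (\<beta> i))) < e" .
  qed
qed

lemma abs_continuous_arc_cong:
  assumes "\<And>s. s \<in> {a..b} \<Longrightarrow> f s = g s" "abs_continuous_arc a b f"
  shows "abs_continuous_arc a b g"
  by (rule abs_continuous_arc_dominated[OF assms(2), of _ 1]) (use assms(1) in auto)

text \<open>
  The point where absolute continuity enters the integration theory: cover the null set by an open
  set of measure below the \<open>\<delta>\<close> of absolute continuity and let the gauge keep every interval with
  its tag in the null set inside that open set. The intervals then have small total length, hence
  small total increment, so what happens on a null set is invisible to gauge sums.
\<close>

lemma abs_continuous_arc_null_tags:
  fixes f :: "real \<Rightarrow> 'a::metric_space"
  assumes f: "abs_continuous_arc a b f" and N: "negligible N" and "e > 0"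
  shows "\<exists>\<gamma>. gauge \<gamma> \<and> (\<forall>p. p tagged_partial_division_of {a..b} \<and> \<gamma> fine p \<and> fst ` p \<subseteq> N \<longrightarrow>
      (\<Sum>(x, K)\<in>p. dist (f (Inf K)) (f (Sup K))) < e)"
proof -
  from abs_continuous_arcD[OF f \<open>e > 0\<close>] obtain d where d: "d > 0"
    "\<And>(n::nat) \<alpha> \<beta>. (\<And>i. i < n \<Longrightarrow> a \<le> \<alpha> i \<and> \<alpha> i \<le> \<beta> i \<and> \<beta> i \<le> b) \<Longrightarrow>
      disjoint_family_on (\<lambda>i. {\<alpha> i<..<\<beta> i}) {..<n} \<Longrightarrow>
      (\<Sum>i<n. \<beta> i - \<alpha> i) < d \<Longrightarrow> (\<Sum>i<n. dist (f (\<alpha> i)) (f (\<beta> i))) < e" by blast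
  obtain U where U: "open U" "N \<subseteq> U" "U - N \<in> lmeasurable" "emeasure lebesgue (U - N) < ennreal d"
    using sets_lebesgue_outer_open[OF negligible_imp_sets[OF N] d(1)] .
  have Um: "emeasure lebesgue U < ennreal d"
  proof -
    have "emeasure lebesgue U = emeasure lebesgue ((U - N) \<union> N)"
      using U(2) by (simp add: Un_absorb2)
    also have "\<dots> = emeasure lebesgue (U - N)"
      by (rule emeasure_Un_null_set) (use U(3) N in \<open>auto simp: negligible_iff_null_sets\<close>)
    finally show ?thesis using U(4) by simp
  qed
  show ?thesis
  proof (intro exI conjI allI impI)
    show "gauge (\<lambda>x. if x \<in> N then U else UNIV)"
      using U by (auto simp: gauge_def)
    fix p assume "p tagged_partial_division_of {a..b} \<and>
      (\<lambda>x. if x \<in> N then U else UNIV) fine p \<and> fst ` p \<subseteq> N"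
    then have p: "p tagged_partial_division_of {a..b}"
      and fine: "(\<lambda>x. if x \<in> N then U else UNIV) fine p" and tags: "fst ` p \<subseteq> N" by auto
    note pd = tagged_partial_division_ofD[OF p]
    obtain h where h: "bij_betw h {..<card p} p"
      using ex_bij_betw_nat_finite[OF pd(1)] by (auto simp: atLeast0LessThan)
    define \<alpha> where "\<alpha> i = Inf (snd (h i))" for i
    define \<beta> where "\<beta> i = Sup (snd (h i))" for i
    have K: "snd (h i) = {\<alpha> i..\<beta> i}" "\<alpha> i \<le> \<beta> i" "a \<le> \<alpha> i" "\<beta> i \<le> b" "{\<alpha> i..\<beta> i} \<subseteq> U"
      if "i < card p" for i
    proof -
      have hi: "(fst (h i), snd (h i)) \<in> p" using h that by (auto simp: bij_betw_def)
      obtain u v where uv: "snd (h i) = {u..v}" using pd(4)[OF hi] by auto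
      then have "u \<le> v" using pd(2)[OF hi] by auto
      then have "\<alpha> i = u" "\<beta> i = v" using uv by (auto simp: \<alpha>_def \<beta>_def)
      moreover have "fst (h i) \<in> N" using tags hi by (metis fst_conv image_eqI subsetD)
      then have "snd (h i) \<subseteq> U" using fineD[OF fine hi] by simp
      ultimately show "snd (h i) = {\<alpha> i..\<beta> i}" "\<alpha> i \<le> \<beta> i" "a \<le> \<alpha> i" "\<beta> i \<le> b" "{\<alpha> i..\<beta> i} \<subseteq> U"
        using uv \<open>u \<le> v\<close> pd(3)[OF hi] by auto
    qed
    have disj: "disjoint_family_on (\<lambda>i. {\<alpha> i<..<\<beta> i}) {..<card p}"
      unfolding disjoint_family_on_def
    proof (intro ballI impI)
      fix i j assume ij: "i \<in> {..<card p}" "j \<in> {..<card p}" "i \<noteq> j"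
      then have "h i \<in> p" "h j \<in> p" "h i \<noteq> h j"
        using h by (auto simp: bij_betw_def inj_on_def)
      then have "interior (snd (h i)) \<inter> interior (snd (h j)) = {}"
        by (metis pd(5) prod.collapse)
      then show "{\<alpha> i<..<\<beta> i} \<inter> {\<alpha> j<..<\<beta> j} = {}" using K ij by simp
    qed
    have "ennreal (\<Sum>i<card p. \<beta> i - \<alpha> i) = (\<Sum>i<card p. ennreal (\<beta> i - \<alpha> i))"
      using K(2) by (subst sum_ennreal) auto
    also have "\<dots> = (\<Sum>i<card p. emeasure lebesgue {\<alpha> i<..<\<beta> i})"
      using K(2) by (intro sum.cong) auto
    also have "\<dots> = emeasure lebesgue (\<Union>i<card p. {\<alpha> i<..<\<beta> i})"
      by (rule sum_emeasure) (use disj in auto)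
    also have "\<dots> \<le> emeasure lebesgue U"
    proof (rule emeasure_mono)
      show "(\<Union>i<card p. {\<alpha> i<..<\<beta> i}) \<subseteq> U" using K(5) by fastforce
      show "U \<in> sets lebesgue" using U(1) by (simp add: borel_open)
    qed
    also have "\<dots> < ennreal d" by (rule Um)
    finally have "(\<Sum>i<card p. \<beta> i - \<alpha> i) < d"
      using d(1) by (meson ennreal_leI not_le)
    then have "(\<Sum>i<card p. dist (f (\<alpha> i)) (f (\<beta> i))) < e"
      using K disj by (intro d(2)) auto
    also have "(\<Sum>i<card p. dist (f (\<alpha> i)) (f (\<beta> i))) = (\<Sum>z\<in>p. dist (f (Inf (snd z))) (f (Sup (snd z))))"
      unfolding \<alpha>_def \<beta>_def
      by (rule sum.reindex_bij_betw[OF h, of "\<lambda>z. dist (f (Inf (snd z))) (f (Sup (snd z)))"])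
    finally show "(\<Sum>(x, K)\<in>p. dist (f (Inf K)) (f (Sup K))) < e"
      by (simp add: case_prod_unfold)
  qed
qed

text \<open>
  Off the null set each increment is at most \<open>(g + \<epsilon>)\<close> times the length of the interval, by the
  local bound, and the intervals tagged in the null set contribute little by the preceding lemma.
  The bound is one-sided so that it serves both for an upper bound on a speed, where \<open>F\<close> need not be
  differentiable, and, applied to \<open>F\<close> and \<open>- F\<close>, for a derivative.
\<close>

lemma abs_continuous_arc_riemann_upper:
  fixes F g :: "real \<Rightarrow> real"
  assumes F: "abs_continuous_arc a b F" and "a \<le> b" and N: "negligible N"
    and loc: "\<And>s e. s \<in> {a..b} - N \<Longrightarrow> e > 0 \<Longrightarrow> \<exists>d>0. \<forall>r\<in>{a..b}. \<bar>r - s\<bar> < d \<longrightarrow>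
       (s \<le> r \<longrightarrow> F r - F s \<le> (g s + e) * (r - s)) \<and> (r \<le> s \<longrightarrow> F s - F r \<le> (g s + e) * (s - r))"
    and "e > 0"
  shows "\<exists>\<gamma>. gauge \<gamma> \<and> (\<forall>p. p tagged_division_of {a..b} \<and> \<gamma> fine p \<longrightarrow>
      F b - F a \<le> (\<Sum>(x, K)\<in>p. measure lborel K * (if x \<in> N then 0 else g x)) + e)"
proof -
  define e' where "e' = e / (2 * (b - a + 1))"
  have e': "e' > 0" using \<open>e > 0\<close> \<open>a \<le> b\<close> by (simp add: e'_def)
  have "e / 2 > 0" using \<open>e > 0\<close> by simp
  obtain \<gamma>1 where \<gamma>1: "gauge \<gamma>1"
    "\<And>p. p tagged_partial_division_of {a..b} \<Longrightarrow> \<gamma>1 fine p \<Longrightarrow> fst ` p \<subseteq> N \<Longrightarrow>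
      (\<Sum>(x, K)\<in>p. dist (F (Inf K)) (F (Sup K))) < e / 2"
    using abs_continuous_arc_null_tags[OF F N \<open>e/2 > 0\<close>]
      by (elim exE conjE) (rule that, assumption, erule allE, erule mp, blast)
  have "\<exists>d. \<forall>s. s \<in> {a..b} - N \<longrightarrow> d s > 0 \<and> (\<forall>r\<in>{a..b}. \<bar>r - s\<bar> < d s \<longrightarrow>
       (s \<le> r \<longrightarrow> F r - F s \<le> (g s + e') * (r - s)) \<and> (r \<le> s \<longrightarrow> F s - F r \<le> (g s + e') * (s - r)))"
  proof (rule choice, rule allI)
    fix s
    show "\<exists>d. s \<in> {a..b} - N \<longrightarrow> d > 0 \<and> (\<forall>r\<in>{a..b}. \<bar>r - s\<bar> < d \<longrightarrow>
       (s \<le> r \<longrightarrow> F r - F s \<le> (g s + e') * (r - s)) \<and> (r \<le> s \<longrightarrow> F s - F r \<le> (g s + e') * (s - r)))"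
    proof (cases "s \<in> {a..b} - N")
      case True
      show ?thesis using loc[OF True e'] by (elim exE) (rule exI, blast)
    qed auto
  qed
  then obtain d where d: "\<And>s. s \<in> {a..b} - N \<Longrightarrow> d s > 0"
    "\<And>s r. s \<in> {a..b} - N \<Longrightarrow> r \<in> {a..b} \<Longrightarrow> \<bar>r - s\<bar> < d s \<Longrightarrow>
      (s \<le> r \<longrightarrow> F r - F s \<le> (g s + e') * (r - s)) \<and> (r \<le> s \<longrightarrow> F s - F r \<le> (g s + e') * (s - r))"
    by blast
  define \<gamma> where "\<gamma> x = \<gamma>1 x \<inter> (if x \<in> {a..b} - N then ball x (d x) else UNIV)" for x
  show ?thesis
  proof (intro exI conjI allI impI)
    show "gauge \<gamma>" using \<gamma>1(1) d(1) by (auto simp: gauge_def \<gamma>_def)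
    fix p assume "p tagged_division_of {a..b} \<and> \<gamma> fine p"
    then have p: "p tagged_division_of {a..b}" and fine: "\<gamma> fine p" by auto
    note pd = tagged_division_ofD[OF p]
    let ?D = "\<lambda>(x, K). F (Sup K) - F (Inf K)"
    define pN where "pN = {z \<in> p. fst z \<in> N}"
    have 1: "(\<Sum>z\<in>pN. ?D z) \<le> e / 2"
    proof -
      have "pN tagged_partial_division_of {a..b}"
        by (rule tagged_partial_division_subset[of p])
          (use p in \<open>auto simp: tagged_division_of_def pN_def\<close>)
      moreover have "\<gamma>1 fine pN" using fine by (force simp: fine_def pN_def \<gamma>_def)
      ultimately have "(\<Sum>(x, K)\<in>pN. dist (F (Inf K)) (F (Sup K))) < e / 2"
        by (rule \<gamma>1(2)) (auto simp: pN_def)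
      moreover have "(\<Sum>z\<in>pN. ?D z) \<le> (\<Sum>(x, K)\<in>pN. dist (F (Inf K)) (F (Sup K)))"
        by (rule sum_mono) (auto simp: dist_real_def)
      ultimately show ?thesis by linarith
    qed
    have 2: "(\<Sum>z\<in>p - pN. ?D z) \<le> (\<Sum>(x, K)\<in>p - pN. measure lborel K * (if x \<in> N then 0 else g x) + measure lborel K * e')"
    proof (rule sum_mono)
      fix z assume z: "z \<in> p - pN"
      obtain x K where zx: "z = (x, K)" by force
      have xK: "(x, K) \<in> p" "x \<notin> N" using z by (auto simp: zx pN_def)
      obtain u v where uv: "K = {u..v}" using pd(4)[OF xK(1)] by auto
      have x: "x \<in> {u..v}" "{u..v} \<subseteq> {a..b}" using pd(2,3)[OF xK(1)] uv by auto
      have sub: "{u..v} \<subseteq> ball x (d x)"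
        using fineD[OF fine xK(1)] xK(2) x uv by (auto simp: \<gamma>_def split: if_splits)
      have "u \<in> {u..v}" "v \<in> {u..v}" using x by auto
      then have "u \<in> ball x (d x)" "v \<in> ball x (d x)" using sub by blast+
      then have "\<bar>u - x\<bar> < d x" "\<bar>v - x\<bar> < d x" by (auto simp: dist_real_def)
      then have "F v - F x \<le> (g x + e') * (v - x)" "F x - F u \<le> (g x + e') * (x - u)"
        using d(2)[of x u] d(2)[of x v] x xK(2) by auto
      then have "F v - F u \<le> (v - u) * g x + (v - u) * e'" by (simp add: algebra_simps)
      then show "?D z \<le> (case z of (x, K) \<Rightarrow> measure lborel K * (if x \<in> N then 0 else g x) + measure lborel K * e')"
        using x xK(2) by (simp add: zx uv)
    qed
    have "F b - F a = (\<Sum>z\<in>p. ?D z)"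
      using additive_tagged_division_1[OF \<open>a \<le> b\<close> p, of F] by simp
    also have "\<dots> = (\<Sum>z\<in>p - pN. ?D z) + (\<Sum>z\<in>pN. ?D z)"
      by (rule sum.subset_diff) (auto simp: pN_def pd(1))
    also have "\<dots> \<le> (\<Sum>(x, K)\<in>p - pN. measure lborel K * (if x \<in> N then 0 else g x) + measure lborel K * e') + e / 2"
      using 1 2 by linarith
    also have "(\<Sum>(x, K)\<in>p - pN. measure lborel K * (if x \<in> N then 0 else g x) + measure lborel K * e') \<le>
        (\<Sum>(x, K)\<in>p. measure lborel K * (if x \<in> N then 0 else g x) + measure lborel K * e')"
      by (rule sum_mono2) (use e' pd(1) in \<open>auto simp: pN_def\<close>)
    also have "\<dots> = (\<Sum>(x, K)\<in>p. measure lborel K * (if x \<in> N then 0 else g x)) + (b - a) * e'"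
    proof -
      have "(\<Sum>(x, K)\<in>p. measure lborel K) = b - a"
        using additive_content_tagged_division[of p a b] p \<open>a \<le> b\<close> by simp
      then have "(\<Sum>(x, K)\<in>p. measure lborel K * e') = (b - a) * e'"
        by (simp add: case_prod_unfold sum_distrib_right[symmetric])
      then show ?thesis by (simp add: case_prod_unfold sum.distrib)
    qed
    also have "(b - a) * e' \<le> e / 2"
      using \<open>e > 0\<close> \<open>a \<le> b\<close> by (simp add: e'_def divide_simps mult_le_cancel_left)
    finally show "F b - F a \<le> (\<Sum>(x, K)\<in>p. measure lborel K * (if x \<in> N then 0 else g x)) + e"
      by simp
  qed
qed

lemma abs_continuous_arc_increment_le_integral:
  fixes F g :: "real \<Rightarrow> real"
  assumes F: "abs_continuous_arc a b F" and "a \<le> b" and N: "negligible N"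
    and loc: "\<And>s e. s \<in> {a..b} - N \<Longrightarrow> e > 0 \<Longrightarrow> \<exists>d>0. \<forall>r\<in>{a..b}. \<bar>r - s\<bar> < d \<longrightarrow>
       \<bar>F r - F s\<bar> \<le> (g s + e) * \<bar>r - s\<bar>"
    and g: "(g has_integral I) {a..b}"
  shows "F b - F a \<le> I"
proof (rule field_le_epsilon)
  fix e :: real assume "e > 0"
  then have e2: "e / 2 > 0" by simp
  have loc': "\<exists>d>0. \<forall>r\<in>{a..b}. \<bar>r - s\<bar> < d \<longrightarrow>
       (s \<le> r \<longrightarrow> F r - F s \<le> (g s + e) * (r - s)) \<and> (r \<le> s \<longrightarrow> F s - F r \<le> (g s + e) * (s - r))"
    if se: "s \<in> {a..b} - N" "e > 0" for s e
  proof -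
    obtain d where d: "d > 0" "\<And>r. r \<in> {a..b} \<Longrightarrow> \<bar>r - s\<bar> < d \<Longrightarrow> \<bar>F r - F s\<bar> \<le> (g s + e) * \<bar>r - s\<bar>"
      using loc[OF se] by (elim exE conjE) (rule that; blast)
    show ?thesis
    proof (intro exI conjI ballI impI)
      show "d > 0" by (rule d)
      fix r assume r: "r \<in> {a..b}" "\<bar>r - s\<bar> < d"
      show "F r - F s \<le> (g s + e) * (r - s)" if "s \<le> r" using d(2)[OF r] that by auto
      show "F s - F r \<le> (g s + e) * (s - r)" if "r \<le> s" using d(2)[OF r] that by auto
    qed
  qed
  obtain \<gamma>1 where \<gamma>1: "gauge \<gamma>1"
    "\<And>p. p tagged_division_of {a..b} \<Longrightarrow> \<gamma>1 fine p \<Longrightarrow>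
      F b - F a \<le> (\<Sum>(x, K)\<in>p. measure lborel K * (if x \<in> N then 0 else g x)) + e / 2"
    by (rule exE[OF abs_continuous_arc_riemann_upper[OF F \<open>a \<le> b\<close> N loc' e2]], assumption+, elim conjE,
        rule that, assumption, erule allE, erule mp, blast)
  have "((\<lambda>x. if x \<in> N then 0 else g x) has_integral I) {a..b}"
    by (rule has_integral_spike[OF N _ g]) auto
  then obtain \<gamma>2 where \<gamma>2: "gauge \<gamma>2"
    "\<And>p. p tagged_division_of {a..b} \<Longrightarrow> \<gamma>2 fine p \<Longrightarrow>
      norm ((\<Sum>(x, K)\<in>p. measure lborel K *\<^sub>R (if x \<in> N then 0 else g x)) - I) < e / 2"
    using e2 unfolding has_integral_real by meson
  obtain p where "p tagged_division_of {a..b}" "(\<lambda>x. \<gamma>1 x \<inter> \<gamma>2 x) fine p"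
    using fine_division_exists_real[OF gauge_Int[OF \<gamma>1(1) \<gamma>2(1)]] .
  then have "F b - F a \<le> (\<Sum>(x, K)\<in>p. measure lborel K * (if x \<in> N then 0 else g x)) + e / 2"
    "\<bar>(\<Sum>(x, K)\<in>p. measure lborel K * (if x \<in> N then 0 else g x)) - I\<bar> < e / 2"
    using \<gamma>1(2)[of p] \<gamma>2(2)[of p] by (simp_all only: fine_Int real_norm_def real_scaleR_def)
  then show "F b - F a \<le> I + e" by linarith
qed

text \<open>
  The fundamental theorem of calculus for absolutely continuous functions. Integrability of the
  derivative is part of the conclusion, because the gauge sums themselves are shown to converge.
\<close>

lemma abs_continuous_arc_has_integral_derivative:
  fixes F g :: "real \<Rightarrow> real"
  assumes F: "abs_continuous_arc a b F" and "a \<le> b" and N: "negligible N"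
    and der: "\<And>s. s \<in> {a..b} - N \<Longrightarrow> (F has_real_derivative g s) (at s within {a..b})"
  shows "(g has_integral F b - F a) {a..b}"
proof -
  have up: "\<exists>d>0. \<forall>r\<in>{a..b}. \<bar>r - s\<bar> < d \<longrightarrow>
       (s \<le> r \<longrightarrow> G r - G s \<le> (h s + e) * (r - s)) \<and> (r \<le> s \<longrightarrow> G s - G r \<le> (h s + e) * (s - r))"
    if "s \<in> {a..b} - N" "e > 0" "(G has_real_derivative h s) (at s within {a..b})" for s e and G h :: "real \<Rightarrow> real"
  proof -
    have "(G has_derivative (*) (h s)) (at s within {a..b})"
      using that(3) by (simp add: has_field_derivative_def)
    then obtain d where d: "d > 0"
      "\<And>r. r \<in> {a..b} \<Longrightarrow> norm (r - s) < d \<Longrightarrow> norm (G r - G s - h s * (r - s)) \<le> e * norm (r - s)"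
      using \<open>e > 0\<close> unfolding has_derivative_within_alt by blast
    show ?thesis
    proof (intro exI conjI ballI impI)
      show "d > 0" by (rule d)
      fix r assume r: "r \<in> {a..b}" "\<bar>r - s\<bar> < d"
      then have *: "\<bar>G r - G s - h s * (r - s)\<bar> \<le> e * \<bar>r - s\<bar>" using d(2)[of r] by simp
      show "G r - G s \<le> (h s + e) * (r - s)" if "s \<le> r" using * that by (auto simp: algebra_simps)
      show "G s - G r \<le> (h s + e) * (s - r)" if "r \<le> s" using * that by (auto simp: algebra_simps)
    qed
  qed
  note upF = up[of _ _ F g, OF _ _ der]
  note upF' = up[of _ _ "\<lambda>s. - F s" "\<lambda>s. - g s", OF _ _ DERIV_minus[OF der]]
  have F': "abs_continuous_arc a b (\<lambda>s. - F s)"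
    by (rule abs_continuous_arc_dominated[OF F, of _ 1]) (auto simp: dist_real_def)
  let ?g = "\<lambda>x. if x \<in> N then 0 else g x"
  have "(?g has_integral F b - F a) {a..b}"
    unfolding has_integral_real
  proof (intro allI impI)
    fix e :: real assume "e > 0"
    then have e2: "e / 2 > 0" by simp
    obtain \<gamma>1 where \<gamma>1: "gauge \<gamma>1"
      "\<And>p. p tagged_division_of {a..b} \<Longrightarrow> \<gamma>1 fine p \<Longrightarrow>
        F b - F a \<le> (\<Sum>(x, K)\<in>p. measure lborel K * (if x \<in> N then 0 else g x)) + e / 2"
      by (rule exE[OF abs_continuous_arc_riemann_upper[OF F \<open>a \<le> b\<close> N upF e2]], assumption+, elim conjE,
        rule that, assumption, erule allE, erule mp, blast)
    obtain \<gamma>2 where \<gamma>2: "gauge \<gamma>2"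
      "\<And>p. p tagged_division_of {a..b} \<Longrightarrow> \<gamma>2 fine p \<Longrightarrow>
        - F b - - F a \<le> (\<Sum>(x, K)\<in>p. measure lborel K * (if x \<in> N then 0 else - g x)) + e / 2"
      by (rule exE[OF abs_continuous_arc_riemann_upper[OF F' \<open>a \<le> b\<close> N upF' e2]], assumption+, elim conjE,
        rule that, assumption, erule allE, erule mp, blast)
    have neg: "(\<Sum>(x, K)\<in>p. measure lborel K * (if x \<in> N then 0 else - g x)) = - (\<Sum>(x, K)\<in>p. measure lborel K * ?g x)"
      for p :: "(real \<times> real set) set"
      by (auto simp: sum_negf[symmetric] intro!: sum.cong)
    show "\<exists>\<gamma>. gauge \<gamma> \<and> (\<forall>p. p tagged_division_of {a..b} \<and> \<gamma> fine p \<longrightarrow>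
        norm ((\<Sum>(x, K)\<in>p. measure lborel K *\<^sub>R ?g x) - (F b - F a)) < e)"
    proof (intro exI[of _ "\<lambda>x. \<gamma>1 x \<inter> \<gamma>2 x"] conjI allI impI)
      show "gauge (\<lambda>x. \<gamma>1 x \<inter> \<gamma>2 x)" using \<gamma>1 \<gamma>2 by auto
      fix p assume "p tagged_division_of {a..b} \<and> (\<lambda>x. \<gamma>1 x \<inter> \<gamma>2 x) fine p"
      then have "F b - F a \<le> (\<Sum>(x, K)\<in>p. measure lborel K * ?g x) + e / 2"
        "- F b - - F a \<le> - (\<Sum>(x, K)\<in>p. measure lborel K * ?g x) + e / 2"
        using \<gamma>1(2)[of p] \<gamma>2(2)[of p] by (auto simp: fine_Int neg)
      then show "norm ((\<Sum>(x, K)\<in>p. measure lborel K *\<^sub>R ?g x) - (F b - F a)) < e"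
        using \<open>e > 0\<close> by simp
    qed
  qed
  then show ?thesis
    by (rule has_integral_spike[OF N, rotated]) auto
qed

section \<open>Translations and velocities on the torus\<close>

lemma torus_exp_proj: "torus_exp (torus_proj x) v = torus_proj (x + v)"
  by (rule torus_exp.abs_eq)

lemma torus_exp_exp: "torus_exp (torus_exp p v) w = torus_exp p (v + w)"
proof -
  obtain x where "p = torus_proj x" using torus_proj_surj by metis
  then show ?thesis by (simp add: torus_exp_proj add.assoc)
qed

lemma torus_exp_0 [simp]: "torus_exp p 0 = p"
proof -
  obtain x where "p = torus_proj x" using torus_proj_surj by metis
  then show ?thesis by (simp add: torus_exp_proj)
qed

lemma dist_torus_exp_le: "dist p (torus_exp p v) \<le> norm v"
proof -
  obtain x where "p = torus_proj x" using torus_proj_surj by metis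
  then show ?thesis
    using torus_dist_le[of x "x + v"] by (simp add: torus_exp_proj dist_torus_def)
qed

text \<open>
  Suitable representatives of the two points in the universal cover realise the distance up to any
  margin; their difference is the required tangent vector.
\<close>

lemma torus_displacement:
  assumes "dist p q < e"
  obtains w where "norm w < e" "q = torus_exp p w"
proof -
  obtain x y where xy: "torus_proj x = p" "torus_proj y = q" "norm (x - y) < e"
    using assms by (auto simp: dist_torus_def elim: torus_dist_approx)
  show thesis
  proof
    show "norm (y - x) < e" using xy(3) by (simp add: norm_minus_commute)
    show "q = torus_exp p (y - x)" using xy(1,2) torus_exp_proj[of x "y - x"] by simp
  qed
qed

lemma dist_torus_exp_translate: "dist (torus_exp p w) (torus_exp q w) = dist p q"
proof -
  have le: "dist (torus_exp p w) (torus_exp q w) \<le> dist p q" for p q :: "'a torus" and w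
  proof (rule field_le_epsilon)
    fix e :: real assume "e > 0"
    then have "dist p q < dist p q + e" by simp
    then obtain v where v: "norm v < dist p q + e" "q = torus_exp p v"
      by (rule torus_displacement)
    have "torus_exp q w = torus_exp (torus_exp p w) v"
      by (simp add: v(2) torus_exp_exp add.commute)
    then show "dist (torus_exp p w) (torus_exp q w) \<le> dist p q + e"
      using dist_torus_exp_le[of "torus_exp p w" v] v(1) by simp
  qed
  have "dist p q \<le> dist (torus_exp p w) (torus_exp q w)"
    using le[of "torus_exp p w" "- w" "torus_exp q w"] by (simp add: torus_exp_exp)
  with le show ?thesis by (rule antisym)
qed

lemma torus_diameter: "\<exists>D>0. \<forall>p q :: 'n::finite torus. \<exists>w. norm w \<le> D \<and> q = torus_exp p w"
proof -
  obtain D where D: "\<And>p q :: 'n torus. dist p q \<le> D"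
    using compact_imp_bounded[OF compact_UNIV_torus] unfolding bounded_two_points by blast
  show ?thesis
  proof (rule exI[of _ "\<bar>D\<bar> + 1"], intro conjI allI)
    show "\<bar>D\<bar> + 1 > 0" by simp
    fix p q :: "'n torus"
    have "dist p q < \<bar>D\<bar> + 1" using D[of p q] by linarith
    then obtain w where "norm w < \<bar>D\<bar> + 1" "q = torus_exp p w"
      by (rule torus_displacement)
    then show "\<exists>w. norm w \<le> \<bar>D\<bar> + 1 \<and> q = torus_exp p w"
      by (intro exI[of _ w]) simp
  qed
qed

lemma has_torus_velocity_translate:
  assumes "has_torus_velocity \<xi> v s S"
  shows "has_torus_velocity (\<lambda>r. torus_exp (\<xi> r) w) v s S"
proof -
  have "torus_exp (torus_exp (\<xi> s) w) u = torus_exp (torus_exp (\<xi> s) u) w" for u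
    by (simp add: torus_exp_exp add.commute)
  then show ?thesis
    using assms by (simp add: has_torus_velocity_def dist_torus_exp_translate)
qed

lemma has_torus_velocity_geodesic:
  "has_torus_velocity (\<lambda>r. torus_exp y ((r - a) *\<^sub>R v)) v s S"
proof -
  have "torus_exp (torus_exp y ((s - a) *\<^sub>R v)) ((r - s) *\<^sub>R v) = torus_exp y ((r - a) *\<^sub>R v)" for r
    by (simp add: torus_exp_exp scaleR_left_distrib[symmetric])
  then show ?thesis by (simp add: has_torus_velocity_def)
qed

lemma has_torus_velocity_subset:
  "has_torus_velocity \<xi> v s S \<Longrightarrow> S' \<subseteq> S \<Longrightarrow> has_torus_velocity \<xi> v s S'"
  unfolding has_torus_velocity_def by (rule tendsto_within_subset)

text \<open>
  Arcs are glued below. At an interior point of a piece the velocity depends only on that piece;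
  the finitely many junction times can be put into the exceptional null set.
\<close>

lemma has_torus_velocity_transform_interior:
  assumes v: "has_torus_velocity \<xi> v s {a..b}" and s: "a < s" "s < b"
    and eq: "\<And>r. a < r \<Longrightarrow> r < b \<Longrightarrow> \<eta> r = \<xi> r"
  shows "has_torus_velocity \<eta> v s S"
proof -
  have "at s within {a..b} = at s"
    by (rule at_within_interior) (use s in simp)
  then have lim: "((\<lambda>r. dist (\<xi> r) (torus_exp (\<xi> s) ((r - s) *\<^sub>R v)) / \<bar>r - s\<bar>) \<longlongrightarrow> 0) (at s)"
    using v by (simp add: has_torus_velocity_def)
  have "((\<lambda>r. dist (\<eta> r) (torus_exp (\<eta> s) ((r - s) *\<^sub>R v)) / \<bar>r - s\<bar>) \<longlongrightarrow> 0) (at s)"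
    by (rule Lim_transform_within_open[OF lim, of "{a<..<b}"]) (use s eq in auto)
  then show ?thesis
    unfolding has_torus_velocity_def by (rule tendsto_within_subset) simp
qed

lemma has_real_derivative_transform_interior:
  fixes p :: "real \<Rightarrow> real"
  assumes p: "(p has_real_derivative D) (at s within {a..b})" and s: "a < s" "s < b"
    and eq: "\<And>r. a < r \<Longrightarrow> r < b \<Longrightarrow> g r = p r"
  shows "(g has_real_derivative D) (at s within S)"
proof -
  have "at s within {a..b} = at s"
    by (rule at_within_interior) (use s in simp)
  then have "(p has_real_derivative D) (at s)" using p by simp
  then have "(g has_real_derivative D) (at s)"
    by (rule has_field_derivative_transform_within_open[of _ _ _ "{a<..<b}"]) (use s eq in auto)
  then show ?thesis by (rule has_field_derivative_at_within)
qed

text \<open>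
  Having velocity \<open>v\<close> means being \<open>o(r - s)\<close>-close to the geodesic with that velocity, and the
  geodesic moves at speed at most \<open>norm v\<close>.
\<close>

lemma has_torus_velocity_speed:
  assumes "has_torus_velocity \<xi> v s S" and "e > 0"
  obtains d where "d > 0"
    "\<And>r. r \<in> S \<Longrightarrow> \<bar>r - s\<bar> < d \<Longrightarrow> dist (\<xi> r) (\<xi> s) \<le> (norm v + e) * \<bar>r - s\<bar>"
proof -
  obtain d where d: "d > 0" "\<And>r. r \<in> S \<Longrightarrow> r \<noteq> s \<Longrightarrow> dist r s < d \<Longrightarrow>
      dist (dist (\<xi> r) (torus_exp (\<xi> s) ((r - s) *\<^sub>R v)) / \<bar>r - s\<bar>) 0 < e"
    using assms unfolding has_torus_velocity_def tendsto_iff eventually_at by blast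
  show thesis
  proof
    show "d > 0" by (rule d)
    fix r assume r: "r \<in> S" "\<bar>r - s\<bar> < d"
    show "dist (\<xi> r) (\<xi> s) \<le> (norm v + e) * \<bar>r - s\<bar>"
    proof (cases "r = s")
      case False
      then have "dist (\<xi> r) (torus_exp (\<xi> s) ((r - s) *\<^sub>R v)) < e * \<bar>r - s\<bar>"
        using d(2)[OF r(1)] r(2) by (simp add: dist_real_def divide_simps)
      moreover have "dist (\<xi> s) (torus_exp (\<xi> s) ((r - s) *\<^sub>R v)) \<le> \<bar>r - s\<bar> * norm v"
        using dist_torus_exp_le[of "\<xi> s" "(r - s) *\<^sub>R v"] by simp
      ultimately show ?thesis
        using dist_triangle2[of "\<xi> r" "\<xi> s" "torus_exp (\<xi> s) ((r - s) *\<^sub>R v)"]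
        by (simp add: algebra_simps)
    qed simp
  qed
qed

section \<open>Discounted transport costs\<close>

lemma AE_lebesgue_on_iff_negligible:
  "(AE s in lebesgue_on {a..b::real}. P s) \<longleftrightarrow> (\<exists>N. negligible N \<and> (\<forall>s\<in>{a..b} - N. P s))"
proof -
  have "(AE s in lebesgue_on {a..b}. P s) \<longleftrightarrow> (AE s in lebesgue. s \<in> {a..b} \<longrightarrow> P s)"
    by (rule AE_restrict_space_iff) simp
  also have "\<dots> \<longleftrightarrow> (\<exists>N. negligible N \<and> (\<forall>s\<in>{a..b} - N. P s))"
    unfolding eventually_ae_filter_negligible by (rule ex_cong1) auto
  finally show ?thesis .
qed

lemma exp_diff_le:
  fixes x y :: real
  shows "exp x - exp y \<le> exp x * (x - y)"
proof -
  have "exp x * (1 + (y - x)) \<le> exp x * exp (y - x)"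
    by (intro mult_left_mono exp_ge_add_one_self) simp
  also have "\<dots> = exp y" by (simp add: exp_add[symmetric])
  finally show ?thesis by (simp add: algebra_simps)
qed

lemma exp_weight_lipschitz:
  fixes lam :: real
  assumes "lam > 0" "a \<le> s" "s \<le> r"
  shows "\<bar>exp (lam * (T - s)) - exp (lam * (T - r))\<bar> \<le> lam * exp (lam * (T - a)) * (r - s)"
proof -
  have "exp (lam * (T - s)) - exp (lam * (T - r)) \<le> exp (lam * (T - s)) * (lam * (r - s))"
    using exp_diff_le[of "lam * (T - s)" "lam * (T - r)"] by (simp add: algebra_simps)
  also have "\<dots> \<le> exp (lam * (T - a)) * (lam * (r - s))"
    using assms by (intro mult_right_mono) auto
  finally have "exp (lam * (T - s)) - exp (lam * (T - r)) \<le> lam * exp (lam * (T - a)) * (r - s)"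
    by (simp add: mult_ac)
  moreover have "exp (lam * (T - r)) \<le> exp (lam * (T - s))"
    using assms by simp
  ultimately show ?thesis by simp
qed

text \<open>
  \<open>q\<close> is the discounted action \<open>\<integral> exp (lam (T - s)) l (\<xi>' s) ds\<close> of some arc from \<open>y\<close> at time \<open>a\<close> to
  \<open>x\<close> at time \<open>b\<close>. The integral is encoded by an absolutely continuous primitive \<open>p\<close> rather than as
  an integral: then its derivative is given, and gluing and restricting arcs amounts to gluing and
  restricting \<open>p\<close>.
  The final time \<open>T\<close> of the discount is kept apart from \<open>b\<close>, so that costs of consecutive pieces of
  one arc simply add up.
\<close>

definition transport_cost ::
    "(real ^ 'n::finite \<Rightarrow> real) \<Rightarrow> real \<Rightarrow> real \<Rightarrow> real \<Rightarrow> real \<Rightarrow> 'n torus \<Rightarrow> 'n torus \<Rightarrow> real \<Rightarrow> bool" where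
  "transport_cost l lam T a b y x q \<longleftrightarrow>
    (\<exists>\<xi> \<xi>' p N. abs_continuous_arc a b \<xi> \<and> abs_continuous_arc a b p \<and>
      \<xi> a = y \<and> \<xi> b = x \<and> p b - p a = q \<and> negligible N \<and>
      (\<forall>s\<in>{a..b} - N. has_torus_velocity \<xi> (\<xi>' s) s {a..b} \<and>
        (p has_real_derivative exp (lam * (T - s)) * l (\<xi>' s)) (at s within {a..b})))"

lemma transport_cost_translate:
  assumes "transport_cost l lam T a b y x q"
  shows "transport_cost l lam T a b (torus_exp y w) (torus_exp x w) q"
proof -
  obtain \<xi> \<xi>' p N where *: "abs_continuous_arc a b \<xi>" "abs_continuous_arc a b p"
    "\<xi> a = y" "\<xi> b = x" "p b - p a = q" "negligible N"
    "\<And>s. s \<in> {a..b} - N \<Longrightarrow> has_torus_velocity \<xi> (\<xi>' s) s {a..b}"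
    "\<And>s. s \<in> {a..b} - N \<Longrightarrow> (p has_real_derivative exp (lam * (T - s)) * l (\<xi>' s)) (at s within {a..b})"
    using assms unfolding transport_cost_def by blast
  have "abs_continuous_arc a b (\<lambda>r. torus_exp (\<xi> r) w)"
    by (rule abs_continuous_arc_dominated[OF *(1), of _ 1]) (simp add: dist_torus_exp_translate)
  then show ?thesis
    unfolding transport_cost_def using * has_torus_velocity_translate[OF *(7)]
    by (intro exI[of _ "\<lambda>r. torus_exp (\<xi> r) w"] exI[of _ \<xi>'] exI[of _ p] exI[of _ N]) simp
qed

lemma transport_cost_refl: "transport_cost l lam T a a x x 0"
  unfolding transport_cost_def
  by (rule exI[of _ "\<lambda>_. x"], rule exI, rule exI[of _ "\<lambda>_. 0"], rule exI[of _ "{a}"])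
    (auto intro!: abs_continuous_arc_lipschitz[of _ _ _ 0])

lemma transport_cost_split:
  assumes "transport_cost l lam T a c y x q" "a \<le> b" "b \<le> c"
  obtains z q1 q2 where "transport_cost l lam T a b y z q1" "transport_cost l lam T b c z x q2"
    "q = q1 + q2"
proof -
  obtain \<xi> \<xi>' p N where *: "abs_continuous_arc a c \<xi>" "abs_continuous_arc a c p"
    "\<xi> a = y" "\<xi> c = x" "p c - p a = q" "negligible N"
    "\<And>s. s \<in> {a..c} - N \<Longrightarrow> has_torus_velocity \<xi> (\<xi>' s) s {a..c}"
    "\<And>s. s \<in> {a..c} - N \<Longrightarrow> (p has_real_derivative exp (lam * (T - s)) * l (\<xi>' s)) (at s within {a..c})"
    using assms(1) unfolding transport_cost_def by blast
  have sub: "transport_cost l lam T a' b' (\<xi> a') (\<xi> b') (p b' - p a')" if ab: "a \<le> a'" "b' \<le> c" for a' b'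
    unfolding transport_cost_def
  proof (intro exI conjI ballI)
    show "abs_continuous_arc a' b' \<xi>" "abs_continuous_arc a' b' p"
      using ab by (auto intro: abs_continuous_arc_subinterval *(1,2))
    show "negligible N" by (rule *(6))
    fix s assume s: "s \<in> {a'..b'} - N"
    show "has_torus_velocity \<xi> (\<xi>' s) s {a'..b'}"
      by (rule has_torus_velocity_subset[OF *(7)]) (use s ab in auto)
    show "(p has_real_derivative exp (lam * (T - s)) * l (\<xi>' s)) (at s within {a'..b'})"
      by (rule DERIV_subset[OF *(8)]) (use s ab in auto)
  qed auto
  show thesis
    by (rule that[of "\<xi> b" "p b - p a" "p c - p b"])
      (use sub[of a b] sub[of b c] assms *(3-5) in auto)
qed

lemma transport_cost_join:
  assumes 1: "transport_cost l lam T a b y z q1" and 2: "transport_cost l lam T b c z x q2"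
    and ab: "a \<le> b" and bc: "b \<le> c"
  shows "transport_cost l lam T a c y x (q1 + q2)"
proof -
  obtain \<xi>1 \<xi>1' p1 N1 where A: "abs_continuous_arc a b \<xi>1" "abs_continuous_arc a b p1"
    "\<xi>1 a = y" "\<xi>1 b = z" "p1 b - p1 a = q1" "negligible N1"
    "\<And>s. s \<in> {a..b} - N1 \<Longrightarrow> has_torus_velocity \<xi>1 (\<xi>1' s) s {a..b}"
    "\<And>s. s \<in> {a..b} - N1 \<Longrightarrow> (p1 has_real_derivative exp (lam * (T - s)) * l (\<xi>1' s)) (at s within {a..b})"
    using 1 unfolding transport_cost_def by blast
  obtain \<xi>2 \<xi>2' p2 N2 where B: "abs_continuous_arc b c \<xi>2" "abs_continuous_arc b c p2"
    "\<xi>2 b = z" "\<xi>2 c = x" "p2 c - p2 b = q2" "negligible N2"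
    "\<And>s. s \<in> {b..c} - N2 \<Longrightarrow> has_torus_velocity \<xi>2 (\<xi>2' s) s {b..c}"
    "\<And>s. s \<in> {b..c} - N2 \<Longrightarrow> (p2 has_real_derivative exp (lam * (T - s)) * l (\<xi>2' s)) (at s within {b..c})"
    using 2 unfolding transport_cost_def by blast
  define \<xi> where "\<xi> s = (if s \<le> b then \<xi>1 s else \<xi>2 s)" for s
  define \<xi>' where "\<xi>' s = (if s \<le> b then \<xi>1' s else \<xi>2' s)" for s
  define p where "p s = (if s \<le> b then p1 s else p2 s + (p1 b - p2 b))" for s
  define N where "N = N1 \<union> N2 \<union> {a, b, c}"
  have \<xi>r: "\<xi> s = \<xi>2 s" if "b \<le> s" for s using that A(4) B(3) by (auto simp: \<xi>_def)
  have pr: "p s = p2 s + (p1 b - p2 b)" if "b \<le> s" for s using that by (auto simp: p_def)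
  have p2': "abs_continuous_arc b c (\<lambda>s. p2 s + (p1 b - p2 b))"
    by (rule abs_continuous_arc_dominated[OF B(2), of _ 1]) (simp add: dist_real_def)
  show ?thesis
    unfolding transport_cost_def
  proof (intro exI conjI ballI)
    show "abs_continuous_arc a c \<xi>"
    proof (rule abs_continuous_arc_join[OF _ _ ab bc])
      show "abs_continuous_arc a b \<xi>"
        by (rule abs_continuous_arc_cong[OF _ A(1)]) (simp add: \<xi>_def)
      show "abs_continuous_arc b c \<xi>"
        by (rule abs_continuous_arc_cong[OF _ B(1)]) (simp add: \<xi>r)
    qed
    show "abs_continuous_arc a c p"
    proof (rule abs_continuous_arc_join[OF _ _ ab bc])
      show "abs_continuous_arc a b p"
        by (rule abs_continuous_arc_cong[OF _ A(2)]) (simp add: p_def)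
      show "abs_continuous_arc b c p"
        by (rule abs_continuous_arc_cong[OF _ p2']) (simp add: pr)
    qed
    show "\<xi> a = y" using ab A(3) by (simp add: \<xi>_def)
    show "\<xi> c = x" using bc B(4) by (simp add: \<xi>r)
    show "p c - p a = q1 + q2" using pr[OF bc] ab A(5) B(5) by (simp add: p_def)
    show "negligible N" by (simp add: N_def A(6) B(6))
    fix s assume s: "s \<in> {a..c} - N"
    show "has_torus_velocity \<xi> (\<xi>' s) s {a..c}"
    proof (cases "s < b")
      case True
      have v: "has_torus_velocity \<xi>1 (\<xi>1' s) s {a..b}" by (rule A(7)) (use s True in \<open>auto simp: N_def\<close>)
      show ?thesis
        using has_torus_velocity_transform_interior[OF v, of \<xi>] s True
        by (auto simp: N_def \<xi>_def \<xi>'_def)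
    next
      case False
      then have v: "has_torus_velocity \<xi>2 (\<xi>2' s) s {b..c}" by (intro B(7)) (use s in \<open>auto simp: N_def\<close>)
      show ?thesis
        using has_torus_velocity_transform_interior[OF v, of \<xi>] s False
        by (auto simp: N_def \<xi>_def \<xi>'_def)
    qed
    show "(p has_real_derivative exp (lam * (T - s)) * l (\<xi>' s)) (at s within {a..c})"
    proof (cases "s < b")
      case True
      have v: "(p1 has_real_derivative exp (lam * (T - s)) * l (\<xi>1' s)) (at s within {a..b})"
        by (rule A(8)) (use s True in \<open>auto simp: N_def\<close>)
      show ?thesis
        using has_real_derivative_transform_interior[OF v, of p] s True
        by (auto simp: N_def p_def \<xi>'_def)
    next
      case False
      then have "(p2 has_real_derivative exp (lam * (T - s)) * l (\<xi>2' s)) (at s within {b..c})"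
        by (intro B(8)) (use s in \<open>auto simp: N_def\<close>)
      then have v: "((\<lambda>s. p2 s + (p1 b - p2 b)) has_real_derivative exp (lam * (T - s)) * l (\<xi>2' s)) (at s within {b..c})"
        by (auto intro!: derivative_eq_intros)
      show ?thesis
        using has_real_derivative_transform_interior[OF v, of p] s False
        by (auto simp: N_def p_def \<xi>'_def)
    qed
  qed
qed

text \<open>
  Along a geodesic \<open>l\<close> is constant, and the discount on \<open>[a, b]\<close> is largest at \<open>a\<close>.
\<close>

lemma transport_cost_geodesic:
  assumes lam: "lam > 0" and "a \<le> b" and "l v \<ge> 0"
  obtains q where "transport_cost l lam T a b y (torus_exp y ((b - a) *\<^sub>R v)) q"
    "q \<le> l v * exp (lam * (T - a)) * (b - a)"
proof
  define p where "p s = - (l v / lam) * exp (lam * (T - s))" for s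
  have lip: "\<bar>p s - p r\<bar> \<le> l v * exp (lam * (T - a)) * (r - s)" if "a \<le> s" "s \<le> r" for s r
  proof -
    have "\<bar>p s - p r\<bar> = \<bar>l v / lam\<bar> * \<bar>exp (lam * (T - s)) - exp (lam * (T - r))\<bar>"
    proof -
      have "p s - p r = - (l v / lam * (exp (lam * (T - s)) - exp (lam * (T - r))))"
        by (simp add: p_def right_diff_distrib)
      then show ?thesis by (simp only: abs_minus_cancel abs_mult)
    qed
    also have "\<dots> = l v / lam * \<bar>exp (lam * (T - s)) - exp (lam * (T - r))\<bar>"
      using assms by simp
    also have "\<dots> \<le> l v / lam * (lam * exp (lam * (T - a)) * (r - s))"
      by (rule mult_left_mono[OF exp_weight_lipschitz[OF lam that]]) (use assms in simp)
    also have "\<dots> = l v * exp (lam * (T - a)) * (r - s)" using lam by simp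
    finally show ?thesis .
  qed
  show "transport_cost l lam T a b y (torus_exp y ((b - a) *\<^sub>R v)) (p b - p a)"
    unfolding transport_cost_def
  proof (intro exI conjI ballI)
    show "abs_continuous_arc a b (\<lambda>s. torus_exp y ((s - a) *\<^sub>R v))"
    proof (rule abs_continuous_arc_lipschitz)
      fix s r :: real assume "s \<le> r"
      have "torus_exp y ((r - a) *\<^sub>R v) = torus_exp (torus_exp y ((s - a) *\<^sub>R v)) ((r - s) *\<^sub>R v)"
        by (simp add: torus_exp_exp scaleR_left_distrib[symmetric])
      then show "dist (torus_exp y ((s - a) *\<^sub>R v)) (torus_exp y ((r - a) *\<^sub>R v)) \<le> norm v * (r - s)"
        using dist_torus_exp_le[of "torus_exp y ((s - a) *\<^sub>R v)" "(r - s) *\<^sub>R v"] \<open>s \<le> r\<close>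
        by (simp add: mult.commute)
    qed
    show "abs_continuous_arc a b p"
      by (rule abs_continuous_arc_lipschitz) (use lip in \<open>auto simp: dist_real_def\<close>)
    show "negligible {}" by simp
    fix s assume "s \<in> {a..b} - {}"
    show "has_torus_velocity (\<lambda>s. torus_exp y ((s - a) *\<^sub>R v)) v s {a..b}"
      by (rule has_torus_velocity_geodesic)
    show "(p has_real_derivative exp (lam * (T - s)) * l v) (at s within {a..b})"
      unfolding p_def using lam by (auto intro!: derivative_eq_intros)
  qed auto
  show "p b - p a \<le> l v * exp (lam * (T - a)) * (b - a)"
    using lip[of a b] \<open>a \<le> b\<close> by simp
qed

text \<open>
  Here \<open>l\<close> dominates the speed and the discount factor is at least 1 before time \<open>T\<close>, so the cost
  dominates the length of the arc.
\<close>

lemma dist_le_transport_cost: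
  assumes c: "transport_cost l lam T a b y x q" and lam: "lam > 0" and "a \<le> b" "b \<le> T"
    and l: "\<And>v. norm v \<le> l v"
  shows "dist y x \<le> q"
proof -
  obtain \<xi> \<xi>' p N where *: "abs_continuous_arc a b \<xi>" "abs_continuous_arc a b p"
    "\<xi> a = y" "\<xi> b = x" "p b - p a = q" "negligible N"
    "\<And>s. s \<in> {a..b} - N \<Longrightarrow> has_torus_velocity \<xi> (\<xi>' s) s {a..b}"
    "\<And>s. s \<in> {a..b} - N \<Longrightarrow> (p has_real_derivative exp (lam * (T - s)) * l (\<xi>' s)) (at s within {a..b})"
    using c unfolding transport_cost_def by blast
  have dd: "\<bar>dist y p - dist y q\<bar> \<le> dist p q" for p q
    using dist_triangle[of y p q] dist_triangle[of y q p] by (simp add: dist_commute)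
  have "dist y (\<xi> b) - dist y (\<xi> a) \<le> p b - p a"
  proof (rule abs_continuous_arc_increment_le_integral[where F = "\<lambda>s. dist y (\<xi> s)", OF _ \<open>a \<le> b\<close> *(6) _
        abs_continuous_arc_has_integral_derivative[OF *(2) \<open>a \<le> b\<close> *(6) *(8)]])
    show "abs_continuous_arc a b (\<lambda>s. dist y (\<xi> s))"
    proof (rule abs_continuous_arc_dominated[OF *(1), of _ 1])
      fix s r :: real assume "s \<le> r"
      then show "dist (dist y (\<xi> s)) (dist y (\<xi> r)) \<le> 1 * (dist (\<xi> s) (\<xi> r) + (r - s))"
        using dd[of "\<xi> s" "\<xi> r"] by (simp add: dist_real_def)
    qed
    fix s e :: real assume s: "s \<in> {a..b} - N" and "e > 0"
    obtain d where d: "d > 0"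
      "\<And>r. r \<in> {a..b} \<Longrightarrow> \<bar>r - s\<bar> < d \<Longrightarrow> dist (\<xi> r) (\<xi> s) \<le> (norm (\<xi>' s) + e) * \<bar>r - s\<bar>"
      using has_torus_velocity_speed[OF *(7)[OF s] \<open>e > 0\<close>] by metis
    have "norm (\<xi>' s) \<le> l (\<xi>' s)" by (rule l)
    also have "\<dots> \<le> exp (lam * (T - s)) * l (\<xi>' s)"
    proof -
      have "0 \<le> l (\<xi>' s)" using l[of "\<xi>' s"] norm_ge_zero order_trans by blast
      moreover have "1 \<le> exp (lam * (T - s))" using lam s \<open>b \<le> T\<close> by simp
      ultimately show ?thesis using mult_right_mono by fastforce
    qed
    finally have sp: "norm (\<xi>' s) + e \<le> exp (lam * (T - s)) * l (\<xi>' s) + e" by simp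
    show "\<exists>d>0. \<forall>r\<in>{a..b}. \<bar>r - s\<bar> < d \<longrightarrow> \<bar>dist y (\<xi> r) - dist y (\<xi> s)\<bar>
        \<le> (exp (lam * (T - s)) * l (\<xi>' s) + e) * \<bar>r - s\<bar>"
    proof (intro exI conjI ballI impI)
      show "d > 0" by (rule d)
      fix r assume r: "r \<in> {a..b}" "\<bar>r - s\<bar> < d"
      have "\<bar>dist y (\<xi> r) - dist y (\<xi> s)\<bar> \<le> dist (\<xi> r) (\<xi> s)"
        by (rule dd)
      also have "\<dots> \<le> (norm (\<xi>' s) + e) * \<bar>r - s\<bar>" by (rule d(2)[OF r])
      also have "\<dots> \<le> (exp (lam * (T - s)) * l (\<xi>' s) + e) * \<bar>r - s\<bar>"
        by (rule mult_right_mono[OF sp]) simp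
      finally show "\<bar>dist y (\<xi> r) - dist y (\<xi> s)\<bar> \<le> \<dots>" .
    qed
  qed
  then show ?thesis using *(3-5) by simp
qed

lemma transport_cost_nonneg:
  assumes "transport_cost l lam T a b y x q" "lam > 0" "a \<le> b" "b \<le> T" "\<And>v. norm v \<le> l v"
  shows "0 \<le> q"
  using dist_le_transport_cost[OF assms] zero_le_dist order_trans by blast

section \<open>Moving the source of an arc\<close>

text \<open>
  If an arc over \<open>n + 1\<close> equal time steps costs at most \<open>(n + 1) B\<close>, one of the steps
  costs at most \<open>B\<close>; the arc is exhibited as the part before, this step, and the part after.
\<close>

lemma transport_cost_pigeonhole:
  assumes "transport_cost l lam T a (a + real (Suc n) * \<delta>) z x q" "q \<le> real (Suc n) * B" "\<delta> \<ge> 0"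
  shows "\<exists>s z1 z2 q1 q2 q3. a \<le> s \<and> s + \<delta> \<le> a + real (Suc n) * \<delta> \<and> q2 \<le> B \<and> q = q1 + q2 + q3 \<and>
    transport_cost l lam T a s z z1 q1 \<and> transport_cost l lam T s (s + \<delta>) z1 z2 q2 \<and>
    transport_cost l lam T (s + \<delta>) (a + real (Suc n) * \<delta>) z2 x q3"
  using assms
proof (induction n arbitrary: x q)
  case 0
  then show ?case
    using transport_cost_refl[of l lam T a z] transport_cost_refl[of l lam T "a + \<delta>" x]
    by (intro exI[of _ a] exI[of _ z] exI[of _ x] exI[of _ 0] exI[of _ q] exI[of _ 0]) simp
next
  case (Suc n)
  define b where "b = a + real (Suc n) * \<delta>"
  have b: "a \<le> b" "b \<le> b + \<delta>" "a + real (Suc (Suc n)) * \<delta> = b + \<delta>"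
    using Suc.prems(3) by (auto simp: b_def algebra_simps)
  obtain x1 qa qb where s: "transport_cost l lam T a b z x1 qa"
    "transport_cost l lam T b (b + \<delta>) x1 x qb" "q = qa + qb"
    using transport_cost_split[OF Suc.prems(1)[unfolded b(3)] b(1,2)] .
  show ?case
  proof (cases "qb \<le> B")
    case True
    then show ?thesis
      unfolding b(3) using s b transport_cost_refl[of l lam T "b + \<delta>" x]
      by (intro exI[of _ b] exI[of _ x1] exI[of _ x] exI[of _ qa] exI[of _ qb] exI[of _ 0]) simp
  next
    case False
    then have "qa \<le> real (Suc n) * B" using Suc.prems(2) s(3) by (simp add: algebra_simps)
    from Suc.IH[OF s(1)[unfolded b_def] this Suc.prems(3)]
    obtain r z1 z2 q1 q2 q3 where r: "a \<le> r" "r + \<delta> \<le> b" "q2 \<le> B" "qa = q1 + q2 + q3"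
      "transport_cost l lam T a r z z1 q1" "transport_cost l lam T r (r + \<delta>) z1 z2 q2"
      "transport_cost l lam T (r + \<delta>) b z2 x1 q3" unfolding b_def by blast
    have "transport_cost l lam T (r + \<delta>) (b + \<delta>) z2 x (q3 + qb)"
      by (rule transport_cost_join[OF r(7) s(2)]) (use r b in auto)
    then show ?thesis
      unfolding b(3) using r s(3) b
      by (intro exI[of _ r] exI[of _ z1] exI[of _ z2] exI[of _ q1] exI[of _ q2] exI[of _ "q3 + qb"]) simp
  qed
qed

text \<open>
  The uniform continuity estimate behind the upper bound on the entropy: moving the source by
  \<open>R / (m + 1)\<close> raises the cost by at most \<open>K / (m + 1)\<close>, with \<open>K\<close> independent of the duration
  \<open>t \<ge> \<tau>\<close> although the discount at time 0 is \<open>exp (lam t)\<close>. The reason is that the correction can be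
  made late. In the last \<open>\<tau>\<close> units of time the discount stays below \<open>exp (lam \<tau>)\<close>, and the arc may be
  assumed to cost at most a constant \<open>C\<close> there, since a geodesic would do. Divide this period into
  \<open>m + 1\<close> steps and pick one that costs at most \<open>C / (m + 1)\<close>; during it the arc travels at most
  that far. Translate everything before the step by \<open>w\<close> and replace the step by a geodesic between the
  new end points. Its displacement is of order \<open>1 / (m + 1)\<close>, as is its duration, so its velocity is
  bounded by a constant \<open>r\<close> and its cost is of order \<open>1 / (m + 1)\<close>.
\<close>

lemma transport_cost_move_source:
  fixes l :: "real ^ 'n::finite \<Rightarrow> real"
  assumes lam: "lam > 0" and l: "\<And>v. norm v \<le> l v" and cont: "continuous_on UNIV l"
    and "\<tau> > 0"
  shows "\<exists>K\<ge>0. \<forall>t\<ge>\<tau>. \<forall>m w y x q. norm w \<le> R / real (Suc m) \<longrightarrow> transport_cost l lam t 0 t y x q \<longrightarrow>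
      (\<exists>q'. transport_cost l lam t 0 t (torus_exp y w) x q' \<and> q' \<le> q + K / real (Suc m))"
proof -
  have l0: "0 \<le> l v" for v using l[of v] norm_ge_zero order_trans by blast
  have "\<exists>M. \<forall>v\<in>cball 0 r. l v \<le> M" for r
  proof -
    have "compact (l ` cball 0 r)"
      by (rule compact_continuous_image[OF continuous_on_subset[OF cont]]) auto
    then have "\<exists>M. \<forall>v\<in>cball 0 r. \<bar>l v\<bar> \<le> M"
      using compact_imp_bounded[of "l ` cball 0 r"] by (simp add: bounded_iff)
    then show ?thesis by (meson abs_le_D1)
  qed
  then obtain M where M: "\<And>r v. norm v \<le> r \<Longrightarrow> l v \<le> M r"
    by (metis mem_cball_0)
  obtain D :: real where D: "D > 0" "\<And>p q :: 'n torus. \<exists>w. norm w \<le> D \<and> q = torus_exp p w"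
    using torus_diameter by blast
  have line: "\<exists>q. transport_cost l lam T a b y (torus_exp y w) q \<and>
      q \<le> M r * exp (lam * (T - a)) * (b - a)"
    if ab: "a < b" and w: "norm w \<le> r * (b - a)" for T a b r and y :: "'n torus" and w
  proof -
    define v where "v = w /\<^sub>R (b - a)"
    obtain q where q: "transport_cost l lam T a b y (torus_exp y ((b - a) *\<^sub>R v)) q"
      "q \<le> l v * exp (lam * (T - a)) * (b - a)"
      using transport_cost_geodesic[OF lam less_imp_le[OF ab] l0] .
    have "norm v \<le> r" using ab w by (simp add: v_def field_simps)
    then have "l v \<le> M r" by (rule M)
    then have "q \<le> M r * exp (lam * (T - a)) * (b - a)"
      using ab by (intro order_trans[OF q(2)] mult_right_mono) auto
    moreover have "(b - a) *\<^sub>R v = w" using ab by (simp add: v_def)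
    ultimately show ?thesis using q(1) by auto
  qed
  \<comment> \<open>\<open>C\<close> bounds the cost of a geodesic that lasts \<open>\<tau>\<close>; \<open>r\<close> bounds the speed of the repaired step.\<close>
  define C where "C = M (D / \<tau>) * exp (lam * \<tau>) * \<tau>"
  define r where "r = (C + 1 + \<bar>R\<bar>) / \<tau>"
  define K where "K = M r * exp (lam * \<tau>) * \<tau>"
  have M0: "M r \<ge> 0" if "r \<ge> 0" for r
    using M[of 0 r] l0[of 0] that by simp
  have C0: "C \<ge> 0" unfolding C_def using M0[of "D / \<tau>"] D(1) \<open>\<tau> > 0\<close> by simp
  have r0: "r \<ge> 0" using C0 \<open>\<tau> > 0\<close> by (simp add: r_def)
  have K0: "K \<ge> 0" unfolding K_def using M0[OF r0] \<open>\<tau> > 0\<close> by simp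
  show ?thesis
  proof (rule exI[of _ K], intro conjI K0 allI impI)
    fix t :: real and m :: nat and w :: "real ^ 'n" and y x :: "'n torus" and q
    assume t: "\<tau> \<le> t" and w: "norm w \<le> R / real (Suc m)" and c: "transport_cost l lam t 0 t y x q"
    define a where "a = t - \<tau>"
    have a: "0 \<le> a" "a \<le> t" using t \<open>\<tau> > 0\<close> by (auto simp: a_def)
    obtain z q0 qe where c0: "transport_cost l lam t 0 a y z q0" and ce: "transport_cost l lam t a t z x qe"
      and qe: "q = q0 + qe"
      using transport_cost_split[OF c a] .
    \<comment> \<open>An arc that is more expensive than \<open>C\<close> in its last \<open>\<tau>\<close> units of time ends with a geodesic instead.\<close>
    have "\<exists>q1. transport_cost l lam t a t z x q1 \<and> q1 \<le> C \<and> q1 \<le> qe"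
    proof (cases "qe \<le> C")
      case False
      obtain u where u: "norm u \<le> D" "x = torus_exp z u" using D(2) by blast
      have "\<exists>q1. transport_cost l lam t a t z (torus_exp z u) q1 \<and>
          q1 \<le> M (D / \<tau>) * exp (lam * (t - a)) * (t - a)"
        by (rule line) (use u \<open>\<tau> > 0\<close> in \<open>auto simp: a_def\<close>)
      then show ?thesis using False u(2) by (force simp: C_def a_def)
    qed (use ce in auto)
    then obtain q1 where q1: "transport_cost l lam t a t z x q1" "q1 \<le> C" "q1 \<le> qe" by blast
    define \<delta> where "\<delta> = \<tau> / real (Suc m)"
    have \<delta>: "\<delta> > 0" "a + real (Suc m) * \<delta> = t" using \<open>\<tau> > 0\<close> by (auto simp: \<delta>_def a_def field_simps)
    have "q1 \<le> real (Suc m) * (C / real (Suc m))" using q1(2) by simp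
    from transport_cost_pigeonhole[of l lam t a m \<delta> z x q1, unfolded \<delta>(2), OF q1(1) this] \<delta>(1)
    obtain s z1 z2 qa qb qc where s: "a \<le> s" "s + \<delta> \<le> t" "qb \<le> C / real (Suc m)" "q1 = qa + qb + qc"
      "transport_cost l lam t a s z z1 qa" "transport_cost l lam t s (s + \<delta>) z1 z2 qb"
      "transport_cost l lam t (s + \<delta>) t z2 x qc" by auto
    have qb0: "0 \<le> qb"
      by (rule transport_cost_nonneg[OF s(6) lam _ _ l]) (use s \<delta> in auto)
    have "dist z1 z2 \<le> qb"
      by (rule dist_le_transport_cost[OF s(6) lam _ _ l]) (use s \<delta> in auto)
    also have "\<dots> < (C + 1) / real (Suc m)"
      using s(3) by (simp add: divide_simps)
    finally obtain u where u: "norm u < (C + 1) / real (Suc m)" "z2 = torus_exp z1 u"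
      by (rule torus_displacement)
    have z2: "z2 = torus_exp (torus_exp z1 w) (u - w)" by (simp add: torus_exp_exp u(2))
    have "norm (u - w) \<le> (C + 1) / real (Suc m) + \<bar>R\<bar> / real (Suc m)"
    proof -
      have "R / real (Suc m) \<le> \<bar>R\<bar> / real (Suc m)" by (intro divide_right_mono) auto
      then show ?thesis using norm_triangle_ineq4[of u w] u(1) w by linarith
    qed
    also have "\<dots> = (C + 1 + \<bar>R\<bar>) / real (Suc m)" by (rule add_divide_distrib[symmetric])
    also have "\<dots> = r * \<delta>" using \<open>\<tau> > 0\<close> by (simp add: r_def \<delta>_def)
    finally have uw: "norm (u - w) \<le> r * (s + \<delta> - s)" by simp
    obtain qn where qn: "transport_cost l lam t s (s + \<delta>) (torus_exp z1 w) z2 qn"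
      "qn \<le> M r * exp (lam * (t - s)) * \<delta>"
      using line[OF _ uw, of t "torus_exp z1 w"] \<delta>(1) unfolding z2[symmetric] by auto
    have "qn \<le> K / real (Suc m)"
    proof -
      have "exp (lam * (t - s)) \<le> exp (lam * \<tau>)" using lam s(1) by (simp add: a_def)
      then have "M r * exp (lam * (t - s)) * \<delta> \<le> M r * exp (lam * \<tau>) * \<delta>"
        using M0[OF r0] \<delta>(1) by (intro mult_left_mono mult_right_mono) auto
      also have "\<dots> = K / real (Suc m)" by (simp add: K_def \<delta>_def)
      finally show ?thesis using qn(2) by simp
    qed
    moreover have "transport_cost l lam t 0 t (torus_exp y w) x (q0 + (qa + (qn + qc)))"
    proof (rule transport_cost_join[OF transport_cost_translate[OF c0] _ a])
      show "transport_cost l lam t a t (torus_exp z w) x (qa + (qn + qc))"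
      proof (rule transport_cost_join[OF transport_cost_translate[OF s(5)] _ s(1)])
        show "transport_cost l lam t s t (torus_exp z1 w) x (qn + qc)"
          by (rule transport_cost_join[OF qn(1) s(7)]) (use s \<delta> in auto)
      qed (use s \<delta> in auto)
    qed
    ultimately show "\<exists>q'. transport_cost l lam t 0 t (torus_exp y w) x q' \<and> q' \<le> q + K / real (Suc m)"
      using qb0 qe q1(3) s(4) by (intro exI conjI) auto
  qed
qed

section \<open>The Lax-Oleinik semigroup as an infimum of costs\<close>

text \<open>
  Superlinear growth gives \<open>\<theta>\<^sub>0 r \<ge> r\<close> beyond some radius; inside it a constant compensates.
\<close>

lemma tonelli_normalization:
  assumes "tonelli l"
  shows "\<exists>c. (\<forall>v. norm v \<le> l v + c) \<and> continuous_on UNIV l"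
proof -
  obtain Dl where Dl: "\<And>v. (l has_derivative (\<lambda>h. Dl v \<bullet> h)) (at v)"
    using assms unfolding tonelli_def by blast
  obtain \<theta> :: "real \<Rightarrow> real" and c where \<theta>: "\<And>r. r \<ge> 0 \<Longrightarrow> \<theta> r \<ge> 0"
    "filterlim (\<lambda>r. \<theta> r / r) at_top at_top" "\<And>v. l v \<ge> \<theta> (norm v) - c"
    using assms unfolding tonelli_def by blast
  have "eventually (\<lambda>r. \<theta> r / r \<ge> 1) at_top"
    using \<theta>(2) by (simp add: filterlim_at_top)
  then obtain R where R: "\<And>r. r \<ge> R \<Longrightarrow> \<theta> r / r \<ge> 1"
    unfolding eventually_at_top_linorder by blast
  show ?thesis
  proof (intro exI[of _ "c + \<bar>R\<bar>"] conjI allI)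
    show "continuous_on UNIV l"
      using Dl by (auto intro!: continuous_at_imp_continuous_on has_derivative_continuous)
    fix v :: "real ^ 'a"
    show "norm v \<le> l v + (c + \<bar>R\<bar>)"
    proof (cases "norm v \<ge> R \<and> norm v > 0")
      case True
      then have "norm v \<le> \<theta> (norm v)" using R[of "norm v"] by (simp add: divide_simps)
      then show ?thesis using \<theta>(3)[of v] by simp
    next
      case False
      then have "norm v \<le> \<bar>R\<bar>" by auto
      then show ?thesis using \<theta>(1)[of "norm v"] \<theta>(3)[of v] by simp
    qed
  qed
qed

lemma integrable_lebesgue_on_iff:
  fixes f :: "real \<Rightarrow> real"
  shows "integrable (lebesgue_on {a..b}) f \<longleftrightarrow> f absolutely_integrable_on {a..b}"
  by (simp add: integrable_restrict_space set_integrable_def)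

text \<open>
  The action functional evaluates to the end value of the Caratheodory solution. Integrability of
  \<open>l (\<xi>')\<close> is a consequence of the existence of the solution, because \<open>l + c\<close> is nonnegative and gauge
  integrable nonnegative functions are Lebesgue integrable.
\<close>

lemma caratheodory_value:
  fixes u :: "real \<Rightarrow> real" and l :: "'b \<Rightarrow> real"
  assumes u: "abs_continuous_arc 0 t u" and "t \<ge> 0" and N: "negligible N"
    and der: "\<And>s. s \<in> {0..t} - N \<Longrightarrow> (u has_real_derivative l (\<xi>' s) + lam * u s) (at s within {0..t})"
    and l: "\<And>v. l v + c \<ge> 0"
  shows "integrable (lebesgue_on {0..t}) (\<lambda>s. l (\<xi>' s))"
    and "u 0 + (LINT s|lebesgue_on {0..t}. l (\<xi>' s) + lam * u s) = u t"
proof -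
  have int: "((\<lambda>s. l (\<xi>' s) + lam * u s) has_integral u t - u 0) {0..t}"
    by (rule abs_continuous_arc_has_integral_derivative[OF u \<open>t \<ge> 0\<close> N der])
  have "continuous_on {0..t} (\<lambda>s. lam * u s)"
    by (intro continuous_intros abs_continuous_arc_imp_continuous_on[OF u])
  then have "(\<lambda>s. lam * u s) absolutely_integrable_on {0..t}"
    by (rule absolutely_integrable_continuous_real)
  then have ui: "integrable (lebesgue_on {0..t}) (\<lambda>s. lam * u s)"
    by (simp only: integrable_lebesgue_on_iff)
  have uh: "(\<lambda>s. lam * u s) integrable_on {0..t}"
    by (rule integrable_continuous_real) fact
  have "(\<lambda>s. l (\<xi>' s) + lam * u s) integrable_on {0..t}"
    using int by blast
  from integrable_diff[OF this uh] have "(\<lambda>s. l (\<xi>' s)) integrable_on {0..t}" by simp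
  from integrable_add[OF this integrable_const_ivl[of c 0 t]]
  have "(\<lambda>s. l (\<xi>' s) + c) integrable_on {0..t}" .
  then have "(\<lambda>s. l (\<xi>' s) + c) absolutely_integrable_on {0..t}"
    by (rule nonnegative_absolutely_integrable_1) (rule l)
  then have 1: "integrable (lebesgue_on {0..t}) (\<lambda>s. l (\<xi>' s) + c)"
    by (simp add: integrable_restrict_space set_integrable_def)
  have "(\<lambda>s. c) absolutely_integrable_on {0..t}"
    by (rule absolutely_integrable_continuous_real) simp
  then have "integrable (lebesgue_on {0..t}) (\<lambda>s. c)"
    by (simp add: integrable_restrict_space set_integrable_def)
  from Bochner_Integration.integrable_diff[OF 1 this]
  show 2: "integrable (lebesgue_on {0..t}) (\<lambda>s. l (\<xi>' s))" by simp
  have "integrable (lebesgue_on {0..t}) (\<lambda>s. l (\<xi>' s) + lam * u s)"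
    by (rule Bochner_Integration.integrable_add[OF 2 ui])
  then have "(LINT s|lebesgue_on {0..t}. l (\<xi>' s) + lam * u s) = integral {0..t} (\<lambda>s. l (\<xi>' s) + lam * u s)"
    by (rule lebesgue_integral_eq_integral) simp
  also have "\<dots> = u t - u 0" using int by (rule integral_unique)
  finally show "u 0 + (LINT s|lebesgue_on {0..t}. l (\<xi>' s) + lam * u s) = u t" by simp
qed

text \<open>
  The constant \<open>c\<close> is fixed along with the data because all costs are costs of \<open>l + c\<close>, which dominates
  the speed.
\<close>

locale contact_lagrangian =
  fixes l :: "real ^ 'n::finite \<Rightarrow> real" and lam c :: real
    and L :: "'n torus \<Rightarrow> real ^ 'n \<Rightarrow> real \<Rightarrow> real"
  assumes lam: "lam > 0" and norm_le: "norm v \<le> l v + c"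
    and continuous_l: "continuous_on UNIV l"
    and L_eq: "L x v u = l v + lam * u"
begin

abbreviation cost :: "real \<Rightarrow> 'n torus \<Rightarrow> 'n torus \<Rightarrow> real \<Rightarrow> bool" where
  "cost t \<equiv> transport_cost (\<lambda>v. l v + c) lam t 0 t"

text \<open>
  The Caratheodory equation is linear: along an arc, \<open>p s = exp (lam (t - s)) (u s - c / lam)\<close>
  has derivative \<open>exp (lam (t - s)) (l (\<xi>' s) + c)\<close>. Solutions \<open>u\<close> and primitives
  \<open>p\<close> therefore determine each other, and the end value \<open>u t\<close> is an affine expression in the cost
  \<open>p t - p 0\<close> and the initial datum \<open>\<phi> y\<close>.
\<close>

lemma lax_oleinik_value_eq:
  fixes \<phi> :: "'n torus \<Rightarrow>\<^sub>C real"
  assumes t: "t > 0"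
  shows "lax_oleinik_value L t \<phi> x =
    Inf {exp (lam * t) * \<phi> y + q - c * (exp (lam * t) - 1) / lam | y q. cost t y x q}"
proof -
  have t0: "t \<ge> 0" using t by simp
  have l0: "0 \<le> l v + c" for v using norm_le[of v] norm_ge_zero order_trans by blast
  have "{\<phi> (\<xi> 0) + (LINT s|lebesgue_on {0..t}. L (\<xi> s) (\<xi>' s) (u s)) | \<xi> \<xi>' u.
      admissible_arc t x \<xi> \<xi>' \<and>
      integrable (lebesgue_on {0..t}) (\<lambda>s. L (\<xi> s) (\<xi>' s) 0) \<and>
      caratheodory_solution L t \<xi> \<xi>' (\<phi> (\<xi> 0)) u} =
    {exp (lam * t) * \<phi> y + q - c * (exp (lam * t) - 1) / lam | y q. cost t y x q}" (is "?A = ?B")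
  proof (intro equalityI subsetI)
    fix z assume "z \<in> ?A"
    then obtain \<xi> \<xi>' u where z: "z = \<phi> (\<xi> 0) + (LINT s|lebesgue_on {0..t}. l (\<xi>' s) + lam * u s)"
      and adm: "admissible_arc t x \<xi> \<xi>'" and car: "caratheodory_solution L t \<xi> \<xi>' (\<phi> (\<xi> 0)) u"
      unfolding L_eq by blast
    obtain N1 where N1: "negligible N1" "\<And>s. s \<in> {0..t} - N1 \<Longrightarrow> has_torus_velocity \<xi> (\<xi>' s) s {0..t}"
      using adm unfolding admissible_arc_def AE_lebesgue_on_iff_negligible by blast
    obtain N2 where N2: "negligible N2"
      "\<And>s. s \<in> {0..t} - N2 \<Longrightarrow> (u has_real_derivative l (\<xi>' s) + lam * u s) (at s within {0..t})"
      using car unfolding caratheodory_solution_def AE_lebesgue_on_iff_negligible L_eq by blast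
    have \<xi>: "abs_continuous_arc 0 t \<xi>" "\<xi> t = x" using adm by (auto simp: admissible_arc_def)
    have u: "abs_continuous_arc 0 t u" "u 0 = \<phi> (\<xi> 0)" using car by (auto simp: caratheodory_solution_def)
    have zu: "z = u t"
      using caratheodory_value(2)[where l = l and \<xi>' = \<xi>', OF u(1) t0 N2 l0] z u(2) by simp
    define p where "p s = exp (lam * (t - s)) * (u s - c / lam)" for s
    have "abs_continuous_arc 0 t (\<lambda>s. u s - c / lam)"
      by (rule abs_continuous_arc_dominated[OF u(1), of _ 1]) (simp add: dist_real_def)
    then have pac: "abs_continuous_arc 0 t p"
      unfolding p_def by (rule abs_continuous_arc_mult_lipschitz[OF _ exp_weight_lipschitz[OF lam]])
    have "cost t (\<xi> 0) x (p t - p 0)"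
      unfolding transport_cost_def
    proof (intro exI conjI ballI)
      show "negligible (N1 \<union> N2)" using N1 N2 by simp
      fix s assume s: "s \<in> {0..t} - (N1 \<union> N2)"
      show "has_torus_velocity \<xi> (\<xi>' s) s {0..t}" using N1(2) s by simp
      have "(u has_real_derivative l (\<xi>' s) + lam * u s) (at s within {0..t})" using N2(2) s by simp
      then have "(p has_real_derivative - lam * exp (lam * (t - s)) * (u s - c / lam) +
          (l (\<xi>' s) + lam * u s) * exp (lam * (t - s))) (at s within {0..t})"
        unfolding p_def by (auto intro!: derivative_eq_intros)
      also have "- lam * exp (lam * (t - s)) * (u s - c / lam) +
          (l (\<xi>' s) + lam * u s) * exp (lam * (t - s)) = exp (lam * (t - s)) * (l (\<xi>' s) + c)"
        using lam by (simp add: field_simps)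
      finally show "(p has_real_derivative exp (lam * (t - s)) * (l (\<xi>' s) + c)) (at s within {0..t})" .
    qed (use \<xi> pac in auto)
    moreover have "z = exp (lam * t) * \<phi> (\<xi> 0) + (p t - p 0) - c * (exp (lam * t) - 1) / lam"
      using lam by (simp add: zu p_def u(2) field_simps)
    ultimately show "z \<in> ?B" by blast
  next
    fix z assume "z \<in> ?B"
    then obtain y q where z: "z = exp (lam * t) * \<phi> y + q - c * (exp (lam * t) - 1) / lam" and "cost t y x q"
      by blast
    then obtain \<xi> \<xi>' p N where *: "abs_continuous_arc 0 t \<xi>" "abs_continuous_arc 0 t p"
      "\<xi> 0 = y" "\<xi> t = x" "p t - p 0 = q" "negligible N"
      "\<And>s. s \<in> {0..t} - N \<Longrightarrow> has_torus_velocity \<xi> (\<xi>' s) s {0..t}"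
      "\<And>s. s \<in> {0..t} - N \<Longrightarrow> (p has_real_derivative exp (lam * (t - s)) * (l (\<xi>' s) + c)) (at s within {0..t})"
      unfolding transport_cost_def by blast
    \<comment> \<open>Inverting the substitution; \<open>k\<close> is chosen so that \<open>u 0 = \<phi> y\<close>.\<close>
    define k where "k = exp (lam * t) * (\<phi> y - c / lam) - p 0"
    define u where "u s = c / lam + exp (lam * (s - t)) * (p s + k)" for s
    have pk: "abs_continuous_arc 0 t (\<lambda>s. p s + k)"
      by (rule abs_continuous_arc_dominated[OF *(2), of _ 1]) (simp add: dist_real_def)
    have "abs_continuous_arc 0 t (\<lambda>s. exp (lam * (s - t)) * (p s + k))"
    proof (rule abs_continuous_arc_mult_lipschitz[OF pk])
      fix s r :: real assume sr: "0 \<le> s" "s \<le> r" "r \<le> t"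
      have "exp (lam * (r - t)) - exp (lam * (s - t)) \<le> exp (lam * (r - t)) * (lam * (r - s))"
        using exp_diff_le[of "lam * (r - t)" "lam * (s - t)"] by (simp add: algebra_simps)
      also have "\<dots> \<le> 1 * (lam * (r - s))"
        by (rule mult_right_mono) (use lam sr in \<open>auto simp: mult_nonneg_nonpos\<close>)
      finally show "\<bar>exp (lam * (s - t)) - exp (lam * (r - t))\<bar> \<le> lam * (r - s)"
        using lam sr by simp
    qed
    then have uac: "abs_continuous_arc 0 t u"
      by (rule abs_continuous_arc_dominated[of _ _ _ _ 1]) (simp add: dist_real_def u_def)
    have du: "(u has_real_derivative l (\<xi>' s) + lam * u s) (at s within {0..t})" if s: "s \<in> {0..t} - N" for s
    proof -
      have "(u has_real_derivative lam * exp (lam * (s - t)) * (p s + k) +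
          (exp (lam * (t - s)) * (l (\<xi>' s) + c)) * exp (lam * (s - t))) (at s within {0..t})"
        unfolding u_def using *(8)[OF s] by (auto intro!: derivative_eq_intros)
      also have "(exp (lam * (t - s)) * (l (\<xi>' s) + c)) * exp (lam * (s - t)) = l (\<xi>' s) + c"
      proof -
        have "exp (lam * (t - s)) * exp (lam * (s - t)) = 1"
          by (simp add: exp_add[symmetric] algebra_simps)
        then show ?thesis by (simp add: mult.commute mult.left_commute)
      qed
      also have "lam * exp (lam * (s - t)) * (p s + k) + (l (\<xi>' s) + c) = l (\<xi>' s) + lam * u s"
        using lam by (simp add: u_def field_simps)
      finally show ?thesis .
    qed
    have e1: "exp (lam * (0 - t)) * exp (lam * t) = 1"
      by (simp add: exp_add[symmetric])
    have "u 0 = c / lam + (exp (lam * (0 - t)) * exp (lam * t)) * (\<phi> y - c / lam)"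
      by (simp add: u_def k_def)
    then have u0: "u 0 = \<phi> (\<xi> 0)" unfolding e1 by (simp add: *(3))
    have ut: "u t = z" using lam *(5) by (simp add: u_def k_def z field_simps)
    have "admissible_arc t x \<xi> \<xi>'"
      unfolding admissible_arc_def AE_lebesgue_on_iff_negligible using *(1,4,6,7) by blast
    moreover have "integrable (lebesgue_on {0..t}) (\<lambda>s. L (\<xi> s) (\<xi>' s) 0)"
      unfolding L_eq using caratheodory_value(1)[where l = l and \<xi>' = \<xi>', OF uac t0 *(6) du l0] by simp
    moreover have "caratheodory_solution L t \<xi> \<xi>' (\<phi> (\<xi> 0)) u"
      unfolding caratheodory_solution_def AE_lebesgue_on_iff_negligible L_eq using uac u0 *(6) du by blast
    moreover have "z = \<phi> (\<xi> 0) + (LINT s|lebesgue_on {0..t}. L (\<xi> s) (\<xi>' s) (u s))"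
      unfolding L_eq using caratheodory_value(2)[where l = l and \<xi>' = \<xi>', OF uac t0 *(6) du l0] ut u0 by simp
    ultimately show "z \<in> ?A" by blast
  qed
  then show ?thesis by (simp add: lax_oleinik_value_def)
qed

lemma cost_nonneg: "cost t y x q \<Longrightarrow> t \<ge> 0 \<Longrightarrow> 0 \<le> q"
  using transport_cost_nonneg[of "\<lambda>v. l v + c" lam t 0 t y x q] lam norm_le by simp

lemma cost_exists: 
  assumes "t > 0"
  obtains q where "cost t x x q"
proof -
  have "0 \<le> l 0 + c" using norm_le[of 0] by simp
  with assms show thesis
    using transport_cost_geodesic[of lam 0 t "\<lambda>v. l v + c" 0 t x] lam that by auto
qed

text \<open>
  Two infima are compared by matching each competitor \<open>(y, q)\<close> with a competitor \<open>(y', q')\<close> that is at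
  most \<open>e\<close> worse. All estimates on the semigroup below have this form.
\<close>

lemma lax_oleinik_value_le:
  fixes \<phi> \<psi> :: "'n torus \<Rightarrow>\<^sub>C real"
  assumes t: "t > 0" and "\<And>y q. cost t y x q \<Longrightarrow>
      \<exists>y' q'. cost t y' x' q' \<and> exp (lam * t) * \<psi> y' + q' \<le> exp (lam * t) * \<phi> y + q + e"
  shows "lax_oleinik_value L t \<psi> x' \<le> lax_oleinik_value L t \<phi> x + e"
proof -
  define k where "k = c * (exp (lam * t) - 1) / lam"
  obtain B where B: "\<And>y. \<bar>\<psi> y\<bar> \<le> B"
    using bounded_apply_bcontfun[of \<psi>] unfolding bounded_iff by auto
  have bdd: "bdd_below {exp (lam * t) * \<psi> y + q - k | y q. cost t y x' q}"
  proof (rule bdd_belowI)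
    fix z assume "z \<in> {exp (lam * t) * \<psi> y + q - k | y q. cost t y x' q}"
    then obtain y q where z: "z = exp (lam * t) * \<psi> y + q - k" "cost t y x' q" by blast
    have "exp (lam * t) * (- B) \<le> exp (lam * t) * \<psi> y"
      using B[of y] by (intro mult_left_mono) auto
    then show "exp (lam * t) * (- B) - k \<le> z" using cost_nonneg[OF z(2)] t z(1) by simp
  qed
  have "lax_oleinik_value L t \<psi> x' - e \<le> lax_oleinik_value L t \<phi> x"
    unfolding lax_oleinik_value_eq[OF t, of \<phi>]
  proof (rule cInf_greatest)
    show "{exp (lam * t) * \<phi> y + q - c * (exp (lam * t) - 1) / lam | y q. cost t y x q} \<noteq> {}"
    proof -
      obtain q where "cost t x x q" by (rule cost_exists[OF t])
      then show ?thesis by blast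
    qed
    fix z assume "z \<in> {exp (lam * t) * \<phi> y + q - c * (exp (lam * t) - 1) / lam | y q. cost t y x q}"
    then obtain y q where z: "z = exp (lam * t) * \<phi> y + q - k" "cost t y x q" by (auto simp: k_def)
    obtain y' q' where y': "cost t y' x' q'" "exp (lam * t) * \<psi> y' + q' \<le> exp (lam * t) * \<phi> y + q + e"
      using assms(2)[OF z(2)] by blast
    have "lax_oleinik_value L t \<psi> x' \<le> exp (lam * t) * \<psi> y' + q' - k"
      unfolding lax_oleinik_value_eq[OF t] k_def[symmetric]
      by (rule cInf_lower[OF _ bdd]) (use y'(1) in blast)
    then show "lax_oleinik_value L t \<psi> x' - e \<le> z" using y'(2) z(1) by simp
  qed
  then show ?thesis by simp
qed

lemma cost_move_source:
  assumes "\<tau> > 0"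
  shows "\<exists>K\<ge>0. \<forall>t\<ge>\<tau>. \<forall>m w y x q. norm w \<le> R / real (Suc m) \<longrightarrow> cost t y x q \<longrightarrow>
      (\<exists>q'. cost t (torus_exp y w) x q' \<and> q' \<le> q + K / real (Suc m))"
  by (rule transport_cost_move_source[OF lam norm_le _ assms]) (intro continuous_intros continuous_l)

text \<open>
  Costs are invariant under translating both end points, so continuity in the end point \<open>x\<close>
  reduces to moving the source back.
\<close>

lemma lax_oleinik_value_bcontfun:
  fixes \<phi> :: "'n torus \<Rightarrow>\<^sub>C real"
  assumes t: "t > 0"
  shows "lax_oleinik_value L t \<phi> \<in> bcontfun"
proof (rule continuous_torus_bcontfun)
  obtain K where K: "K \<ge> 0"
    "\<forall>t'\<ge>t. \<forall>m w y x q. norm w \<le> 1 / real (Suc m) \<longrightarrow> cost t' y x q \<longrightarrow>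
      (\<exists>q'. cost t' (torus_exp y w) x q' \<and> q' \<le> q + K / real (Suc m))"
    using cost_move_source[OF t, of 1] by blast
  have near: "lax_oleinik_value L t \<phi> x' \<le> lax_oleinik_value L t \<phi> x + K / real (Suc m)"
    if xx': "dist x x' < 1 / real (Suc m)" for x x' m
  proof -
    obtain w where w: "norm w < 1 / real (Suc m)" "x' = torus_exp x w"
      using torus_displacement[OF xx'] .
    show ?thesis
    proof (rule lax_oleinik_value_le[OF t])
      fix y q assume "cost t y x q"
      then have "cost t (torus_exp y w) x' q"
        unfolding w(2) by (rule transport_cost_translate)
      then obtain q' where "cost t (torus_exp (torus_exp y w) (- w)) x' q'" "q' \<le> q + K / real (Suc m)"
        using K(2)[rule_format, of t "- w" m "torus_exp y w" x' q] w(1) by auto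
      then show "\<exists>y' q'. cost t y' x' q' \<and>
          exp (lam * t) * \<phi> y' + q' \<le> exp (lam * t) * \<phi> y + q + K / real (Suc m)"
        by (intro exI[of _ y] exI[of _ q']) (simp add: torus_exp_exp)
    qed
  qed
  show "continuous_on UNIV (lax_oleinik_value L t \<phi>)"
    unfolding continuous_on_iff
  proof (intro ballI allI impI)
    fix x :: "'n torus" and e :: real assume "e > 0"
    then obtain m where "K / e < real (Suc m)" using reals_Archimedean2 by (metis less_trans of_nat_less_iff lessI)
    then have m: "K / real (Suc m) < e" using \<open>e > 0\<close> by (simp add: field_simps)
    show "\<exists>d>0. \<forall>x'\<in>UNIV. dist x' x < d \<longrightarrow> dist (lax_oleinik_value L t \<phi> x') (lax_oleinik_value L t \<phi> x) < e"
    proof (intro exI[of _ "1 / real (Suc m)"] conjI ballI impI)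
      fix x' assume "dist x' x < 1 / real (Suc m)"
      then show "dist (lax_oleinik_value L t \<phi> x') (lax_oleinik_value L t \<phi> x) < e"
        using near[of x x' m] near[of x' x m] m by (simp add: dist_commute dist_real_def abs_less_iff)
    qed simp
  qed
qed

lemma apply_lax_oleinik: "t > 0 \<Longrightarrow> apply_bcontfun (lax_oleinik L t \<phi>) x = lax_oleinik_value L t \<phi> x"
  by (simp add: lax_oleinik_def Bcontfun_inverse lax_oleinik_value_bcontfun)

lemma dist_lax_oleinik_leI:
  fixes \<phi> \<psi> :: "'n torus \<Rightarrow>\<^sub>C real"
  assumes t: "t > 0" and "\<And>x y q. cost t y x q \<Longrightarrow>
      \<exists>y' q'. cost t y' x q' \<and> exp (lam * t) * \<psi> y' + q' \<le> exp (lam * t) * \<phi> y + q + e"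
    and "\<And>x y q. cost t y x q \<Longrightarrow>
      \<exists>y' q'. cost t y' x q' \<and> exp (lam * t) * \<phi> y' + q' \<le> exp (lam * t) * \<psi> y + q + e"
  shows "dist (lax_oleinik L t \<phi>) (lax_oleinik L t \<psi>) \<le> e"
proof (rule dist_bound)
  fix x
  show "dist (lax_oleinik L t \<phi> x) (lax_oleinik L t \<psi> x) \<le> e"
    using lax_oleinik_value_le[OF t, of x x \<psi> \<phi> e] lax_oleinik_value_le[OF t, of x x \<phi> \<psi> e] assms(2,3)
    by (auto simp: apply_lax_oleinik[OF t] dist_real_def abs_le_iff)
qed

lemma dist_lax_oleinik_le:
  fixes \<phi> \<psi> :: "'n torus \<Rightarrow>\<^sub>C real"
  assumes "t \<ge> 0"
  shows "dist (lax_oleinik L t \<phi>) (lax_oleinik L t \<psi>) \<le> exp (lam * t) * dist \<phi> \<psi>"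
proof (cases "t = 0")
  case False
  have le: "exp (lam * t) * \<psi> y + q \<le> exp (lam * t) * \<phi> y + q + exp (lam * t) * dist \<phi> \<psi>" for y q and \<phi> \<psi> :: "'n torus \<Rightarrow>\<^sub>C real"
  proof -
    have "\<psi> y \<le> \<phi> y + dist \<phi> \<psi>"
      using dist_bounded[of \<phi> y \<psi>] by (simp add: dist_real_def abs_le_iff)
    then have "exp (lam * t) * \<psi> y \<le> exp (lam * t) * (\<phi> y + dist \<phi> \<psi>)" by (intro mult_left_mono) auto
    then show ?thesis by (simp add: algebra_simps)
  qed
  show ?thesis
  proof (rule dist_lax_oleinik_leI)
    show "t > 0" using assms False by simp
    fix x y q assume c: "cost t y x q"
    show "\<exists>y' q'. cost t y' x q' \<and>
        exp (lam * t) * \<psi> y' + q' \<le> exp (lam * t) * \<phi> y + q + exp (lam * t) * dist \<phi> \<psi>"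
      using c le[of \<psi> y q \<phi>] by blast
    show "\<exists>y' q'. cost t y' x q' \<and>
        exp (lam * t) * \<phi> y' + q' \<le> exp (lam * t) * \<psi> y + q + exp (lam * t) * dist \<phi> \<psi>"
      using c le[of \<phi> y q \<psi>] unfolding dist_commute[of \<psi> \<phi>] by blast
  qed
qed (simp add: lax_oleinik_def)

text \<open>
  Adding a constant \<open>k\<close> to \<open>\<phi>\<close> adds \<open>exp (lam t) k\<close> to the image of \<open>\<phi>\<close> at time \<open>t\<close>.
\<close>

lemma lax_oleinik_const_separation:
  assumes t: "t > 0"
  shows "exp (lam * t) * \<bar>k - k'\<bar> \<le> dist (lax_oleinik L t (const_bcontfun k)) (lax_oleinik L t (const_bcontfun k'))"
proof -
  have shift: "lax_oleinik_value L t (const_bcontfun k') x \<le> lax_oleinik_value L t (const_bcontfun k) x + exp (lam * t) * (k' - k)"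
    for k k' :: real and x
    by (rule lax_oleinik_value_le[OF t]) (auto simp: const_bcontfun.rep_eq algebra_simps)
  have "exp (lam * t) * (k - k') \<le> dist (lax_oleinik L t (const_bcontfun k)) (lax_oleinik L t (const_bcontfun k'))"
    for k k' :: real
    using shift[of k' undefined k] dist_bounded[of "lax_oleinik L t (const_bcontfun k)" undefined "lax_oleinik L t (const_bcontfun k')"]
    by (simp add: apply_lax_oleinik[OF t] dist_real_def algebra_simps abs_le_iff)
  from this[of k k'] this[of k' k] show ?thesis
    by (auto simp: abs_if dist_commute)
qed

end

section \<open>Spanning numbers\<close>

lemma ln_enat_mono:
  assumes "m \<le> n"
  shows "ln_enat m \<le> ln_enat n"
  using assms by (cases m; cases n) auto

lemma spanning_number_leI:
  "finite E \<Longrightarrow> K \<subseteq> (\<Union>x\<in>E. bowen_ball T x t \<epsilon>) \<Longrightarrow> spanning_number T t \<epsilon> K \<le> enat (card E)"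
  unfolding spanning_number_def by (rule Inf_lower) blast

lemma spanning_number_antimono:
  assumes "\<epsilon> \<le> \<epsilon>'"
  shows "spanning_number T t \<epsilon>' K \<le> spanning_number T t \<epsilon> K"
proof -
  have "bowen_ball T x t \<epsilon> \<subseteq> bowen_ball T x t \<epsilon>'" for x
    using assms by (force simp: bowen_ball_def)
  then have "(\<Union>x\<in>E. bowen_ball T x t \<epsilon>) \<subseteq> (\<Union>x\<in>E. bowen_ball T x t \<epsilon>')" for E
    by (intro UN_mono) auto
  then show ?thesis
    unfolding spanning_number_def
    by (intro Inf_superset_mono Collect_mono) (metis (no_types, lifting) order_trans)
qed

text \<open>
  One representative of each nonempty fibre of \<open>code\<close> is the centre of a Bowen ball containing the
  fibre.
\<close>

lemma spanning_number_le_card_code: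
  assumes fin: "finite (code ` V)"
    and close: "\<And>x y s. x \<in> V \<Longrightarrow> y \<in> V \<Longrightarrow> code x = code y \<Longrightarrow> 0 \<le> s \<Longrightarrow> s \<le> t \<Longrightarrow>
      dist (T s x) (T s y) < \<epsilon>"
  shows "spanning_number T t \<epsilon> V \<le> enat (card (code ` V))"
proof -
  define E where "E = inv_into V code ` code ` V"
  have "V \<subseteq> (\<Union>x\<in>E. bowen_ball T x t \<epsilon>)"
  proof
    fix x assume x: "x \<in> V"
    define y where "y = inv_into V code (code x)"
    have "y \<in> V" "code y = code x" "y \<in> E"
      using x by (auto simp: y_def E_def inv_into_into f_inv_into_f)
    then show "x \<in> (\<Union>x\<in>E. bowen_ball T x t \<epsilon>)"
      using close[OF x \<open>y \<in> V\<close>] by (auto simp: bowen_ball_def intro!: bexI[of _ y])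
  qed
  moreover have "finite E" using fin by (simp add: E_def)
  ultimately have "spanning_number T t \<epsilon> V \<le> enat (card E)" by (intro spanning_number_leI)
  also have "card E \<le> card (code ` V)" unfolding E_def by (rule card_image_le[OF fin])
  finally show ?thesis by simp
qed

text \<open>
  A Bowen ball of radius \<open>\<epsilon>\<close> contains no two points whose orbits get \<open>2 \<epsilon>\<close> apart.
\<close>

lemma card_separated_le_spanning_number:
  assumes "finite S" "S \<subseteq> K"
    and sep: "\<And>x y. x \<in> S \<Longrightarrow> y \<in> S \<Longrightarrow> x \<noteq> y \<Longrightarrow> \<exists>s\<in>{0..t}. dist (T s x) (T s y) \<ge> 2 * \<epsilon>"
  shows "enat (card S) \<le> spanning_number T t \<epsilon> K"
  unfolding spanning_number_def
proof (rule Inf_greatest)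
  fix n assume "n \<in> {enat (card E) | E. finite E \<and> K \<subseteq> (\<Union>x\<in>E. bowen_ball T x t \<epsilon>)}"
  then obtain E where E: "n = enat (card E)" "finite E" "K \<subseteq> (\<Union>x\<in>E. bowen_ball T x t \<epsilon>)" by blast
  have "\<forall>x\<in>S. \<exists>z. z \<in> E \<and> x \<in> bowen_ball T z t \<epsilon>" using E(3) assms(2) by blast
  then obtain f where f: "\<And>x. x \<in> S \<Longrightarrow> f x \<in> E \<and> x \<in> bowen_ball T (f x) t \<epsilon>" by metis
  have "inj_on f S"
  proof (rule inj_onI, rule ccontr)
    fix x y assume xy: "x \<in> S" "y \<in> S" "f x = f y" "x \<noteq> y"
    then obtain s where s: "s \<in> {0..t}" "dist (T s x) (T s y) \<ge> 2 * \<epsilon>" using sep by blast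
    have "dist (T s x) (T s (f x)) < \<epsilon>" "dist (T s y) (T s (f x)) < \<epsilon>"
      using f[OF xy(1)] f[OF xy(2)] xy(3) s(1) by (auto simp: bowen_ball_def)
    then show False
      using s(2) dist_triangle2[of "T s x" "T s y" "T s (f x)"] by linarith
  qed
  then have "card S \<le> card E"
    by (rule card_inj_on_le) (use f E(2) in auto)
  then show "enat (card S) \<le> n" by (simp add: E(1))
qed

definition spanning_rate :: "(real \<Rightarrow> 'a::metric_space \<Rightarrow> 'a) \<Rightarrow> 'a set \<Rightarrow> real \<Rightarrow> ereal" where
  "spanning_rate T K \<epsilon> = Limsup at_top (\<lambda>t. ereal (1 / t) * ln_enat (spanning_number T t \<epsilon> K))"

text \<open>
  Spanning numbers decrease in \<open>\<epsilon>\<close>, so the limit at 0 exists and is a supremum.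
\<close>

lemma compact_entropy_eq_SUP: "compact_entropy T K = (SUP \<epsilon>\<in>{0<..}. spanning_rate T K \<epsilon>)"
proof -
  let ?F = "spanning_rate T K"
  have anti: "?F \<epsilon>' \<le> ?F \<epsilon>" if "\<epsilon> \<le> \<epsilon>'" for \<epsilon> \<epsilon>'
    unfolding spanning_rate_def
  proof (rule Limsup_mono)
    show "\<forall>\<^sub>F t in at_top. ereal (1 / t) * ln_enat (spanning_number T t \<epsilon>' K)
        \<le> ereal (1 / t) * ln_enat (spanning_number T t \<epsilon> K)"
      using eventually_gt_at_top[of 0]
      by eventually_elim
        (auto intro!: ereal_mult_left_mono ln_enat_mono spanning_number_antimono that)
  qed
  have "(?F \<longlongrightarrow> (SUP \<epsilon>\<in>{0<..}. ?F \<epsilon>)) (at_right 0)"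
  proof (rule order_tendstoI)
    fix a assume "a < (SUP \<epsilon>\<in>{0<..}. ?F \<epsilon>)"
    then obtain \<epsilon>0 where e0: "\<epsilon>0 > 0" "a < ?F \<epsilon>0" by (auto simp: less_SUP_iff)
    have "\<forall>\<^sub>F \<epsilon> in at_right 0. \<epsilon> < \<epsilon>0"
      using e0(1) unfolding eventually_at_right_field by blast
    then show "\<forall>\<^sub>F \<epsilon> in at_right 0. a < ?F \<epsilon>"
      by eventually_elim (use anti e0(2) in \<open>meson less_imp_le less_le_trans\<close>)
  next
    fix a assume a: "(SUP \<epsilon>\<in>{0<..}. ?F \<epsilon>) < a"
    have "\<forall>\<^sub>F \<epsilon> in at_right 0. (0::real) < \<epsilon>" by (rule eventually_at_right_less)
    then show "\<forall>\<^sub>F \<epsilon> in at_right 0. ?F \<epsilon> < a"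
      by eventually_elim (use a in \<open>meson SUP_upper greaterThan_iff le_less_trans\<close>)
  qed
  then have "Lim (at_right 0) ?F = (SUP \<epsilon>\<in>{0<..}. ?F \<epsilon>)"
    by (intro tendsto_Lim) simp_all
  then show ?thesis by (simp add: compact_entropy_def spanning_rate_def[abs_def])
qed

lemma compact_finite_ball_cover:
  fixes S :: "'a::metric_space set"
  assumes "compact S" "r > 0"
  obtains Y where "finite Y" "Y \<subseteq> S" "S \<subseteq> (\<Union>y\<in>Y. ball y r)"
  by (rule compactE_image[OF assms(1), of S "\<lambda>y. ball y r"]) (use assms(2) in \<open>auto intro: that\<close>)

section \<open>Recovering the semigroup from finitely many minima\<close>

definition min_on :: "'a::topological_space set \<Rightarrow> ('a \<Rightarrow>\<^sub>C real) \<Rightarrow> real" where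
  "min_on S \<phi> = Inf (apply_bcontfun \<phi> ` S)"

lemma torus_min_on_attained:
  fixes \<phi> :: "'n::finite torus \<Rightarrow>\<^sub>C real"
  assumes "closed S" "S \<noteq> {}"
  shows "\<exists>z\<in>S. \<phi> z = min_on S \<phi> \<and> (\<forall>y\<in>S. min_on S \<phi> \<le> \<phi> y)"
proof -
  have "compact S" using compact_Int_closed[OF compact_UNIV_torus assms(1)] by simp
  then obtain z where z: "z \<in> S" "\<forall>y\<in>S. \<phi> z \<le> \<phi> y"
    using continuous_attains_inf[OF _ assms(2), of "apply_bcontfun \<phi>"] by auto
  have "min_on S \<phi> = \<phi> z"
    unfolding min_on_def by (rule cInf_eq_minimum) (use z in auto)
  then show ?thesis using z by auto
qed

context contact_lagrangian
begin

text \<open>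
  The data of \<open>\<phi>\<close> that the semigroup sees up to time \<open>t\<close>: its minimum, to precision
  \<open>\<delta> exp (- lam t)\<close>, and for each ball \<open>cball p r\<close> with \<open>p\<close> in the finite set \<open>Y\<close> the excess of
  the minimum over the ball above the global one. The excess is recorded on a logarithmic scale,
  that is with a fixed relative precision, with \<open>\<delta> exp (- lam t)\<close> added to keep the logarithm
  from running off to \<open>-\<infinity>\<close>.
\<close>

definition profile_close ::
    "'n torus set \<Rightarrow> real \<Rightarrow> real \<Rightarrow> real \<Rightarrow> real \<Rightarrow> ('n torus \<Rightarrow>\<^sub>C real) \<Rightarrow> ('n torus \<Rightarrow>\<^sub>C real) \<Rightarrow> bool" where
  "profile_close Y r \<delta> \<eta> t \<phi> \<psi> \<longleftrightarrow>
    \<bar>min_on UNIV \<phi> - min_on UNIV \<psi>\<bar> * exp (lam * t) \<le> \<delta> \<and>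
    (\<forall>p\<in>Y. \<bar>ln (min_on (cball p r) \<phi> - min_on UNIV \<phi> + \<delta> * exp (- (lam * t))) -
          ln (min_on (cball p r) \<psi> - min_on UNIV \<psi> + \<delta> * exp (- (lam * t)))\<bar> \<le> \<eta>)"

text \<open>
  Let \<open>(y, q)\<close> compete for \<open>\<phi>\<close> at time \<open>s\<close>. Competing instead from a minimum point of \<open>\<phi>\<close>
  raises the cost by at most a constant \<open>K\<close>, so one may assume that \<open>\<phi> y\<close> exceeds the minimum of \<open>\<phi>\<close>
  by at most \<open>K exp (- lam s)\<close>. The ball around \<open>y\<close> then has an excess of that size, so its
  relative error \<open>\<eta>\<close>, magnified by \<open>exp (lam s)\<close>, costs only about \<open>\<eta> K\<close>; this is why a relative
  precision is enough at all times \<open>s\<close> simultaneously. Moving the source from \<open>y\<close> to the point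
  of the ball where \<open>\<psi>\<close> is smallest costs little because the ball is small, and gives a competitor
  for \<open>\<psi>\<close>.
\<close>

lemma lax_oleinik_close_if_profile_close:
  assumes "\<epsilon> > 0"
  shows "\<exists>Y r \<delta> \<eta>. finite Y \<and> r > 0 \<and> \<delta> > 0 \<and> \<eta> > 0 \<and>
    (\<forall>\<phi> \<psi> s t. 1 \<le> s \<longrightarrow> s \<le> t \<longrightarrow> profile_close Y r \<delta> \<eta> t \<phi> \<psi> \<longrightarrow>
      dist (lax_oleinik L s \<phi>) (lax_oleinik L s \<psi>) < \<epsilon>)"
proof -
  obtain D :: real where D: "D > 0" "\<And>p q :: 'n torus. \<exists>w. norm w \<le> D \<and> q = torus_exp p w"
    using torus_diameter by blast
  obtain K where K: "K \<ge> 0" and move: "\<forall>t\<ge>1. \<forall>m w y x q. norm w \<le> D / real (Suc m) \<longrightarrow> cost t y x q \<longrightarrow>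
      (\<exists>q'. cost t (torus_exp y w) x q' \<and> q' \<le> q + K / real (Suc m))"
    using cost_move_source[OF zero_less_one, of D] by blast
  define \<delta> where "\<delta> = \<epsilon> / 8"
  have \<delta>: "\<delta> > 0" using assms by (simp add: \<delta>_def)
  obtain m :: nat where "K / \<delta> < real m" using reals_Archimedean2 by blast
  then have m: "K / real (Suc m) \<le> \<delta>" using \<delta> by (simp add: field_simps)
  \<comment> \<open>Two points of one ball of radius \<open>r\<close> are less than \<open>D / (m + 1)\<close> apart, the distance over which
      the source can be moved at cost at most \<open>\<delta>\<close>.\<close>
  define r where "r = D / (4 * real (Suc m))"
  have r: "r > 0" "2 * r < D / real (Suc m)" using D(1) by (auto simp: r_def field_simps intro!: add_pos_nonneg)
  \<comment> \<open>The relative precision for which an excess of size \<open>K + \<delta>\<close>, after magnification, is known up to \<open>\<delta>\<close>.\<close>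
  define \<eta> where "\<eta> = ln (1 + \<delta> / (K + \<delta>))"
  have \<eta>: "\<eta> > 0" "(exp \<eta> - 1) * (K + \<delta>) = \<delta>"
    using K \<delta> by (simp_all add: \<eta>_def ln_gt_zero add_pos_pos add_pos_nonneg)
  obtain Y :: "'n torus set" where Y: "finite Y" "UNIV \<subseteq> (\<Union>y\<in>Y. ball y r)"
    using compact_finite_ball_cover[OF compact_UNIV_torus r(1)] by metis
  have step: "\<exists>z q'. cost s z x q' \<and> exp (lam * s) * \<psi> z + q' \<le> exp (lam * s) * \<phi> y + q + \<epsilon> / 2"
    if st: "1 \<le> s" "s \<le> t" and prof: "profile_close Y r \<delta> \<eta> t \<phi> \<psi>" and c: "cost s y x q"
    for \<phi> \<psi> s t x y q
  proof -
    have lows: "\<bar>min_on UNIV \<phi> - min_on UNIV \<psi>\<bar> * exp (lam * t) \<le> \<delta>"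
      and locs: "\<And>p. p \<in> Y \<Longrightarrow> \<bar>ln (min_on (cball p r) \<phi> - min_on UNIV \<phi> + \<delta> * exp (- (lam * t))) -
         ln (min_on (cball p r) \<psi> - min_on UNIV \<psi> + \<delta> * exp (- (lam * t)))\<bar> \<le> \<eta>"
      using prof unfolding profile_close_def by auto
    define E where "E = exp (lam * s)"
    have E: "E > 0" "E \<le> exp (lam * t)" using lam st by (auto simp: E_def)
    obtain y0 where y0: "\<phi> y0 = min_on UNIV \<phi>" "\<And>y. min_on UNIV \<phi> \<le> \<phi> y"
      using torus_min_on_attained[of UNIV \<phi>] by auto
    have "\<exists>y1 q1. cost s y1 x q1 \<and> E * \<phi> y1 + q1 \<le> E * \<phi> y + q \<and> E * (\<phi> y1 - min_on UNIV \<phi>) \<le> K"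
    proof (cases "E * (\<phi> y - min_on UNIV \<phi>) \<le> K")
      case False
      obtain w where w: "norm w \<le> D" "y0 = torus_exp y w" using D(2) by blast
      then obtain q1 where "cost s y0 x q1" "q1 \<le> q + K"
        using move[rule_format, OF st(1), of w 0 y x q] c by auto
      then show ?thesis using False y0(1) K
        by (intro exI[of _ y0] exI[of _ q1]) (simp add: algebra_simps)
    qed (use c in blast)
    then obtain y1 q1 where y1: "cost s y1 x q1" "E * \<phi> y1 + q1 \<le> E * \<phi> y + q" "E * (\<phi> y1 - min_on UNIV \<phi>) \<le> K"
      by blast
    obtain p where "p \<in> Y" "y1 \<in> ball p r" using Y(2) by blast
    then have p: "p \<in> Y" "y1 \<in> cball p r" by auto
    have ne: "cball p r \<noteq> {}" using p(2) by blast
    obtain z where z: "z \<in> cball p r" "\<psi> z = min_on (cball p r) \<psi>"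
      using torus_min_on_attained[OF closed_cball ne, of \<psi>] by metis
    have "min_on (cball p r) \<phi> \<le> \<phi> y1"
      using torus_min_on_attained[OF closed_cball ne, of \<phi>] p(2) by metis
    obtain zp where "\<phi> zp = min_on (cball p r) \<phi>"
      using torus_min_on_attained[OF closed_cball ne, of \<phi>] by metis
    have zl: "\<And>y. min_on UNIV \<psi> \<le> \<psi> y"
      using torus_min_on_attained[of UNIV \<psi>] by auto
    define \<sigma> where "\<sigma> = \<delta> * exp (- (lam * t))"
    have \<sigma>: "\<sigma> > 0" "E * \<sigma> \<le> \<delta>"
    proof -
      have "E * exp (- (lam * t)) \<le> exp (lam * t) * exp (- (lam * t))"
        using E(2) by (intro mult_right_mono) auto
      also have "\<dots> = 1" by (simp add: exp_add[symmetric])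
      finally show "E * \<sigma> \<le> \<delta>" using \<delta> mult_left_mono[of "E * exp (- (lam * t))" 1 \<delta>]
        by (simp add: \<sigma>_def mult_ac)
      show "\<sigma> > 0" using \<delta> by (simp add: \<sigma>_def)
    qed
    define a where "a = min_on (cball p r) \<phi> - min_on UNIV \<phi>"
    define b where "b = min_on (cball p r) \<psi> - min_on UNIV \<psi>"
    have a0: "a \<ge> 0" using y0(2)[of zp] \<open>\<phi> zp = min_on (cball p r) \<phi>\<close> by (simp add: a_def)
    have b0: "b \<ge> 0" using zl[of z] z(2) by (simp add: b_def)
    have "ln (b + \<sigma>) \<le> ln (a + \<sigma>) + \<eta>"
      using locs[OF p(1)] by (simp add: a_def b_def \<sigma>_def)
    then have "exp (ln (b + \<sigma>)) \<le> exp (ln (a + \<sigma>)) * exp \<eta>" by (simp add: exp_add[symmetric])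
    then have "b + \<sigma> \<le> (a + \<sigma>) * exp \<eta>" using a0 b0 \<sigma>(1) by simp
    then have "b \<le> a + (exp \<eta> - 1) * (a + \<sigma>)" by (simp add: algebra_simps)
    then have "E * b \<le> E * (a + (exp \<eta> - 1) * (a + \<sigma>))" using E(1) by (intro mult_left_mono) auto
    also have "\<dots> = E * a + (exp \<eta> - 1) * (E * a + E * \<sigma>)" by (simp add: algebra_simps)
    also have "\<dots> \<le> E * a + (exp \<eta> - 1) * (K + \<delta>)"
    proof -
      have "E * a \<le> E * (\<phi> y1 - min_on UNIV \<phi>)"
        using E(1) \<open>min_on (cball p r) \<phi> \<le> \<phi> y1\<close> by (intro mult_left_mono) (auto simp: a_def)
      then have "E * a + E * \<sigma> \<le> K + \<delta>" using y1(3) \<sigma>(2) by linarith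
      then show ?thesis using \<eta>(1) by (intro add_left_mono mult_left_mono) auto
    qed
    finally have Eb: "E * b \<le> E * a + \<delta>" unfolding \<eta>(2) .
    have El: "E * min_on UNIV \<psi> \<le> E * min_on UNIV \<phi> + \<delta>"
    proof -
      have "E * (min_on UNIV \<psi> - min_on UNIV \<phi>) \<le> E * \<bar>min_on UNIV \<phi> - min_on UNIV \<psi>\<bar>" using E(1) by (intro mult_left_mono) auto
      also have "\<dots> \<le> exp (lam * t) * \<bar>min_on UNIV \<phi> - min_on UNIV \<psi>\<bar>" using E(2) by (intro mult_right_mono) auto
      also have "\<dots> \<le> \<delta>" using lows by (simp add: mult.commute)
      finally show ?thesis by (simp add: algebra_simps)
    qed
    have "dist y1 z \<le> 2 * r"
      using dist_triangle2[of y1 z p] p(2) z(1) by (simp add: dist_commute)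
    also have "\<dots> < D / real (Suc m)" by (rule r(2))
    finally obtain w where w: "norm w < D / real (Suc m)" "z = torus_exp y1 w"
      by (rule torus_displacement)
    then obtain q2 where q2: "cost s z x q2" "q2 \<le> q1 + K / real (Suc m)"
      using move[rule_format, OF st(1), of w m y1 x q1] y1(1) by auto
    have "E * \<psi> z + q2 \<le> E * min_on UNIV \<psi> + E * b + q1 + \<delta>"
      using q2(2) m by (simp add: z(2) b_def right_diff_distrib)
    also have "\<dots> \<le> E * min_on (cball p r) \<phi> + q1 + 3 * \<delta>"
      using El Eb by (simp add: a_def right_diff_distrib)
    also have "E * min_on (cball p r) \<phi> \<le> E * \<phi> y1"
      using E(1) \<open>min_on (cball p r) \<phi> \<le> \<phi> y1\<close> by (intro mult_left_mono) auto
    finally have "E * \<psi> z + q2 \<le> E * \<phi> y + q + \<epsilon> / 2"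
      using y1(2) assms by (simp add: \<delta>_def)
    then show ?thesis using q2(1) unfolding E_def by blast
  qed
  show ?thesis
  proof (rule exI[of _ Y], rule exI[of _ r], rule exI[of _ \<delta>], rule exI[of _ \<eta>], intro conjI allI impI)
    fix \<phi> \<psi> :: "'n torus \<Rightarrow>\<^sub>C real" and s t :: real
    assume st: "1 \<le> s" "s \<le> t" and prof: "profile_close Y r \<delta> \<eta> t \<phi> \<psi>"
    have prof': "profile_close Y r \<delta> \<eta> t \<psi> \<phi>"
      using prof by (simp add: profile_close_def abs_minus_commute)
    have "dist (lax_oleinik L s \<phi>) (lax_oleinik L s \<psi>) \<le> \<epsilon> / 2"
      by (rule dist_lax_oleinik_leI[OF _ step[OF st prof] step[OF st prof']]) (use st in auto)
    then show "dist (lax_oleinik L s \<phi>) (lax_oleinik L s \<psi>) < \<epsilon>" using assms by simp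
  qed (use Y(1) r(1) \<delta> \<eta>(1) in auto)
qed

end

section \<open>Counting profiles\<close>

lemma card_floor_interval_le:
  fixes x y :: real
  assumes "x \<le> y"
  shows "real (card {\<lfloor>x\<rfloor>..\<lfloor>y\<rfloor>}) \<le> y - x + 2"
proof -
  have "\<lfloor>x\<rfloor> \<le> \<lfloor>y\<rfloor>" using assms by (rule floor_mono)
  then have "real (card {\<lfloor>x\<rfloor>..\<lfloor>y\<rfloor>}) = of_int \<lfloor>y\<rfloor> - of_int \<lfloor>x\<rfloor> + 1" by simp
  then show ?thesis using of_int_floor_le[of y] floor_correct[of x] by linarith
qed

lemma floor_eq_imp_abs_diff_le:
  fixes x y :: real
  assumes "\<lfloor>x / d\<rfloor> = \<lfloor>y / d\<rfloor>" "d > 0"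
  shows "\<bar>x - y\<bar> \<le> d"
proof -
  have "\<bar>x / d - y / d\<bar> \<le> 1" using assms(1) by linarith
  then have "\<bar>x - y\<bar> / d \<le> 1" using assms(2) by (simp add: diff_divide_distrib[symmetric])
  then show ?thesis using assms(2) by simp
qed

context contact_lagrangian
begin

text \<open>
  Counting profiles. On a compact set of functions the global minimum is bounded, which leaves of the
  order of \<open>exp (lam t)\<close> values at precision \<open>\<delta> exp (- lam t)\<close>. The logarithms of the excesses lie between
  \<open>ln \<delta> - lam t\<close> and a constant, which leaves of the order of \<open>t\<close> values for each of the finitely
  many balls. Times in \<open>[0, 1]\<close> are dealt with by a finite cover of the compact set itself, since the
  semigroup expands by a bounded factor there.
\<close>

lemma spanning_number_upper:
  fixes V :: "('n torus \<Rightarrow>\<^sub>C real) set"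
  assumes V: "compact V" and "\<epsilon> > 0"
  shows "\<exists>A\<ge>1. \<exists>B>0. \<exists>G>0. \<exists>H\<ge>1. \<exists>n. \<forall>t\<ge>1. \<exists>k.
    spanning_number (lax_oleinik L) t \<epsilon> V \<le> enat k \<and>
    real k \<le> A * (B * exp (lam * t) + 2) * (G * t + H) ^ n"
proof -
  obtain Y :: "'n torus set" and r \<delta> \<eta> where Y: "finite Y" and r: "r > 0" and \<delta>: "\<delta> > 0" and \<eta>: "\<eta> > 0"
    and close: "\<forall>\<phi> \<psi> s t. 1 \<le> s \<longrightarrow> s \<le> t \<longrightarrow> profile_close Y r \<delta> \<eta> t \<phi> \<psi> \<longrightarrow>
      dist (lax_oleinik L s \<phi>) (lax_oleinik L s \<psi>) < \<epsilon>"
    using lax_oleinik_close_if_profile_close[OF \<open>\<epsilon> > 0\<close>] by blast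
  \<comment> \<open>Functions within \<open>\<rho>\<close> of a common centre stay \<open>\<epsilon>\<close>-close up to time 1.\<close>
  define \<rho> where "\<rho> = \<epsilon> * exp (- lam) / 2"
  have \<rho>: "\<rho> > 0" using \<open>\<epsilon> > 0\<close> by (simp add: \<rho>_def)
  obtain Z where Z: "finite Z" "V \<subseteq> (\<Union>z\<in>Z. ball z \<rho>)"
    using compact_finite_ball_cover[OF V \<rho>] by metis
  have "\<forall>\<phi>\<in>V. \<exists>z. z \<in> Z \<and> dist z \<phi> < \<rho>"
    using Z(2) unfolding mem_ball[symmetric] by blast
  then obtain cen where cen: "\<And>\<phi>. \<phi> \<in> V \<Longrightarrow> cen \<phi> \<in> Z \<and> dist (cen \<phi>) \<phi> < \<rho>" by metis
  obtain M where M: "M > 0" "\<And>\<phi> x. \<phi> \<in> V \<Longrightarrow> \<bar>\<phi> x\<bar> \<le> M"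
  proof -
    obtain M where "M > 0" "\<forall>\<phi>\<in>V. norm \<phi> \<le> M"
      using compact_imp_bounded[OF V] by (auto simp: bounded_pos)
    then show thesis using that[of M] norm_bounded by (metis order_trans real_norm_def)
  qed
  have low: "\<bar>min_on UNIV \<phi>\<bar> \<le> M" if "\<phi> \<in> V" for \<phi>
    using torus_min_on_attained[of UNIV \<phi>] M(2)[OF that] by (metis UNIV_not_empty closed_UNIV)
  have loc: "min_on UNIV \<phi> \<le> min_on (cball p r) \<phi>" "min_on (cball p r) \<phi> \<le> M" if \<phi>: "\<phi> \<in> V" for \<phi> p
  proof -
    have "cball p r \<noteq> {}" using r by simp
    then obtain z where z: "\<phi> z = min_on (cball p r) \<phi>"
      using torus_min_on_attained[OF closed_cball, of p r \<phi>] by metis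
    have "min_on UNIV \<phi> \<le> \<phi> z"
      using torus_min_on_attained[of UNIV \<phi>] by auto
    then show "min_on UNIV \<phi> \<le> min_on (cball p r) \<phi>" "min_on (cball p r) \<phi> \<le> M"
      using z M(2)[OF \<phi>, of z] by auto
  qed
  define h where "h = ln (2 * M + \<delta>) - ln \<delta>"
  have h: "h \<ge> 0" using M(1) \<delta> by (simp add: h_def)
  show ?thesis
  proof (rule exI[of _ "real (card Z) + 1"], rule conjI[rotated], rule exI[of _ "2 * M / \<delta>"],
      rule conjI[rotated], rule exI[of _ "lam / \<eta>"], rule conjI[rotated], rule exI[of _ "h / \<eta> + 2"],
      rule conjI[rotated], rule exI[of _ "card Y"], intro allI impI)
    fix t :: real assume t: "t \<ge> 1"
    define \<sigma> where "\<sigma> = \<delta> * exp (- (lam * t))"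
    have \<sigma>: "\<sigma> > 0" "\<sigma> \<le> \<delta>" "ln \<sigma> = ln \<delta> - lam * t"
      using \<delta> lam t by (auto simp: \<sigma>_def ln_mult mult_le_cancel_left1)
    define f where "f \<phi> = min_on UNIV \<phi> * exp (lam * t)" for \<phi> :: "'n torus \<Rightarrow>\<^sub>C real"
    define g where "g \<phi> p = ln (min_on (cball p r) \<phi> - min_on UNIV \<phi> + \<sigma>)" for \<phi> :: "'n torus \<Rightarrow>\<^sub>C real" and p
    define code where "code \<phi> = (cen \<phi>, \<lfloor>f \<phi> / \<delta>\<rfloor>, restrict (\<lambda>p. \<lfloor>g \<phi> p / \<eta>\<rfloor>) Y)" for \<phi>
    define I1 where "I1 = {\<lfloor>- M * exp (lam * t) / \<delta>\<rfloor>..\<lfloor>M * exp (lam * t) / \<delta>\<rfloor>}"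
    define I2 where "I2 = {\<lfloor>ln \<sigma> / \<eta>\<rfloor>..\<lfloor>ln (2 * M + \<delta>) / \<eta>\<rfloor>}"
    have sub: "code ` V \<subseteq> Z \<times> I1 \<times> (Y \<rightarrow>\<^sub>E I2)"
    proof (rule image_subsetI)
      fix \<phi> assume \<phi>: "\<phi> \<in> V"
      have "f \<phi> \<le> M * exp (lam * t)" "- M * exp (lam * t) \<le> f \<phi>"
        using low[OF \<phi>] unfolding f_def by (intro mult_right_mono; simp)+
      then have "\<lfloor>f \<phi> / \<delta>\<rfloor> \<in> I1"
        unfolding I1_def atLeastAtMost_iff using less_imp_le[OF \<delta>]
        by (intro conjI floor_mono divide_right_mono)
      moreover have "\<lfloor>g \<phi> p / \<eta>\<rfloor> \<in> I2" for p
      proof -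
        have "min_on (cball p r) \<phi> - min_on UNIV \<phi> \<le> 2 * M" using loc(2)[OF \<phi>, of p] low[OF \<phi>] by linarith
        then have "ln \<sigma> \<le> g \<phi> p" "g \<phi> p \<le> ln (2 * M + \<delta>)"
          using loc(1)[OF \<phi>, of p] \<sigma>(1,2) \<delta> M(1) by (auto simp: g_def)
        then show ?thesis
          unfolding I2_def atLeastAtMost_iff using less_imp_le[OF \<eta>]
          by (intro conjI floor_mono divide_right_mono)
      qed
      ultimately show "code \<phi> \<in> Z \<times> I1 \<times> (Y \<rightarrow>\<^sub>E I2)"
        using cen[OF \<phi>] by (auto simp: code_def)
    qed
    have fin: "finite (Z \<times> I1 \<times> (Y \<rightarrow>\<^sub>E I2))"
      using Z(1) Y by (intro finite_cartesian_product finite_PiE) (auto simp: I1_def I2_def)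
    have "spanning_number (lax_oleinik L) t \<epsilon> V \<le> enat (card (code ` V))"
    proof (rule spanning_number_le_card_code)
      show "finite (code ` V)" using sub fin by (rule finite_subset)
      fix \<phi> \<psi> s assume \<phi>: "\<phi> \<in> V" and \<psi>: "\<psi> \<in> V" and eq: "code \<phi> = code \<psi>" and s: "0 \<le> s" "s \<le> t"
      show "dist (lax_oleinik L s \<phi>) (lax_oleinik L s \<psi>) < \<epsilon>"
      proof (cases "s \<le> 1")
        case True
        have "dist \<phi> \<psi> < 2 * \<rho>"
          using dist_triangle3[of \<phi> \<psi> "cen \<phi>"] cen[OF \<phi>] cen[OF \<psi>] eq by (simp add: code_def)
        then have "exp (lam * s) * dist \<phi> \<psi> < exp (lam * s) * (2 * \<rho>)" by simp
        also have "\<dots> \<le> exp lam * (2 * \<rho>)"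
          using True lam \<rho> by (intro mult_right_mono) auto
        also have "\<dots> = \<epsilon>" by (simp add: \<rho>_def exp_minus)
        finally show ?thesis using dist_lax_oleinik_le[OF s(1), of \<phi> \<psi>] by linarith
      next
        case False
        have "profile_close Y r \<delta> \<eta> t \<phi> \<psi>"
          unfolding profile_close_def
        proof (intro conjI ballI)
          have "\<bar>f \<phi> - f \<psi>\<bar> \<le> \<delta>"
            by (rule floor_eq_imp_abs_diff_le[OF _ \<delta>]) (use eq in \<open>simp add: code_def\<close>)
          then show "\<bar>min_on UNIV \<phi> - min_on UNIV \<psi>\<bar> * exp (lam * t) \<le> \<delta>"
            by (simp add: f_def left_diff_distrib[symmetric] abs_mult)
          fix p assume p: "p \<in> Y"
          have "restrict (\<lambda>p. \<lfloor>g \<phi> p / \<eta>\<rfloor>) Y p = restrict (\<lambda>p. \<lfloor>g \<psi> p / \<eta>\<rfloor>) Y p"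
            using eq by (simp add: code_def)
          then have "\<bar>g \<phi> p - g \<psi> p\<bar> \<le> \<eta>"
            using p by (intro floor_eq_imp_abs_diff_le[OF _ \<eta>]) simp
          then show "\<bar>ln (min_on (cball p r) \<phi> - min_on UNIV \<phi> + \<delta> * exp (- (lam * t))) -
              ln (min_on (cball p r) \<psi> - min_on UNIV \<psi> + \<delta> * exp (- (lam * t)))\<bar> \<le> \<eta>"
            by (simp add: g_def \<sigma>_def)
        qed
        then show ?thesis using close False s by simp
      qed
    qed
    moreover have "real (card (code ` V)) \<le>
        (real (card Z) + 1) * (2 * M / \<delta> * exp (lam * t) + 2) * (lam / \<eta> * t + (h / \<eta> + 2)) ^ card Y"
    proof -
      have "card (code ` V) \<le> card Z * (card I1 * card I2 ^ card Y)"
        using card_mono[OF fin sub] Y by (simp add: card_cartesian_product card_PiE)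
      then have "real (card (code ` V)) \<le> real (card Z * (card I1 * card I2 ^ card Y))"
        by (simp only: of_nat_le_iff)
      also have "\<dots> = real (card Z) * real (card I1) * real (card I2) ^ card Y" by simp
      also have "\<dots> \<le> (real (card Z) + 1) * (2 * M / \<delta> * exp (lam * t) + 2) * (lam / \<eta> * t + (h / \<eta> + 2)) ^ card Y"
      proof (intro mult_mono power_mono)
        have "real (card I1) \<le> M * exp (lam * t) / \<delta> - - M * exp (lam * t) / \<delta> + 2"
          unfolding I1_def using M(1) \<delta>
          by (intro card_floor_interval_le divide_right_mono mult_right_mono) auto
        then show "real (card I1) \<le> 2 * M / \<delta> * exp (lam * t) + 2" by simp
        have "real (card I2) \<le> ln (2 * M + \<delta>) / \<eta> - ln \<sigma> / \<eta> + 2"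
          unfolding I2_def using \<sigma>(1,2) M(1) \<delta> \<eta>
          by (intro card_floor_interval_le divide_right_mono) auto
        also have "\<dots> = lam / \<eta> * t + (h / \<eta> + 2)"
          using \<eta> by (simp add: \<sigma>(3) h_def field_simps)
        finally show "real (card I2) \<le> lam / \<eta> * t + (h / \<eta> + 2)" .
      qed (use M(1) \<delta> in auto)
      finally show ?thesis .
    qed
    ultimately show "\<exists>k. spanning_number (lax_oleinik L) t \<epsilon> V \<le> enat k \<and>
        real k \<le> (real (card Z) + 1) * (2 * M / \<delta> * exp (lam * t) + 2) * (lam / \<eta> * t + (h / \<eta> + 2)) ^ card Y"
      by blast
  qed (use M(1) \<delta> \<eta> lam h in auto)
qed

text \<open>
  A polynomial factor does not contribute to the exponential growth rate.
\<close>

lemma spanning_rate_le: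
  fixes V :: "('n torus \<Rightarrow>\<^sub>C real) set"
  assumes "compact V" "\<epsilon> > 0"
  shows "spanning_rate (lax_oleinik L) V \<epsilon> \<le> ereal lam"
proof -
  obtain A B G H :: real and n :: nat where pos: "A \<ge> 1" "B > 0" "G > 0" "H \<ge> 1"
    and bound: "\<forall>t\<ge>1. \<exists>k. spanning_number (lax_oleinik L) t \<epsilon> V \<le> enat k \<and>
       real k \<le> A * (B * exp (lam * t) + 2) * (G * t + H) ^ n"
    using spanning_number_upper[OF assms] by blast
  define P where "P t = A * (B * exp (lam * t) + 2) * (G * t + H) ^ n" for t
  have lnP: "ln (P t) = ln A + ln (B * exp (lam * t) + 2) + real n * ln (G * t + H)" if "t \<ge> 1" for t
  proof -
    have "B * exp (lam * t) + 2 > 0" "G * t + H > 0" using pos that by (auto intro: add_pos_pos)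
    then show ?thesis using pos by (simp add: P_def ln_mult ln_realpow)
  qed
  have "((\<lambda>t. 1 / t * (ln A + ln (B * exp (lam * t) + 2) + real n * ln (G * t + H))) \<longlongrightarrow> lam) at_top"
    using lam pos by real_asymp
  then have "((\<lambda>t. ereal (1 / t * (ln A + ln (B * exp (lam * t) + 2) + real n * ln (G * t + H)))) \<longlongrightarrow> ereal lam) at_top"
    by simp
  then have "Limsup at_top (\<lambda>t. ereal (1 / t * (ln A + ln (B * exp (lam * t) + 2) + real n * ln (G * t + H)))) = ereal lam"
    by (rule lim_imp_Limsup[rotated]) simp
  moreover have "spanning_rate (lax_oleinik L) V \<epsilon> \<le>
      Limsup at_top (\<lambda>t. ereal (1 / t * (ln A + ln (B * exp (lam * t) + 2) + real n * ln (G * t + H))))"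
    unfolding spanning_rate_def
  proof (rule Limsup_mono)
    show "\<forall>\<^sub>F t in at_top. ereal (1 / t) * ln_enat (spanning_number (lax_oleinik L) t \<epsilon> V)
        \<le> ereal (1 / t * (ln A + ln (B * exp (lam * t) + 2) + real n * ln (G * t + H)))"
      using eventually_ge_at_top[of 1]
    proof eventually_elim
      case (elim t)
      obtain k where k: "spanning_number (lax_oleinik L) t \<epsilon> V \<le> enat k" "real k \<le> P t"
        using bound elim unfolding P_def by blast
      have "ln_enat (spanning_number (lax_oleinik L) t \<epsilon> V) \<le> ln_enat (enat k)"
        by (rule ln_enat_mono[OF k(1)])
      also have "\<dots> \<le> ereal (ln (P t))"
        using k(2) by (cases "k = 0") auto
      finally have "ereal (1 / t) * ln_enat (spanning_number (lax_oleinik L) t \<epsilon> V) \<le> ereal (1 / t) * ereal (ln (P t))"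
        using elim by (intro ereal_mult_left_mono) auto
      then show ?case by (simp add: lnP[OF elim])
    qed
  qed
  ultimately show ?thesis by simp
qed

section \<open>Entropy of the constants\<close>

lemma compact_const_interval: "compact (const_bcontfun ` {0..1::real} :: ('n torus \<Rightarrow>\<^sub>C real) set)"
proof (rule compact_continuous_image)
  show "continuous_on {0..1} (const_bcontfun :: real \<Rightarrow> 'n torus \<Rightarrow>\<^sub>C real)"
    unfolding continuous_on_iff
  proof (intro ballI allI impI)
    fix x e :: real assume "e > 0"
    have "dist (const_bcontfun y :: 'n torus \<Rightarrow>\<^sub>C real) (const_bcontfun x) \<le> dist y x" for y
      by (rule dist_bound) (simp add: const_bcontfun.rep_eq)
    then show "\<exists>d>0. \<forall>y\<in>{0..1}. dist y x < d \<longrightarrow>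
        dist (const_bcontfun y :: 'n torus \<Rightarrow>\<^sub>C real) (const_bcontfun x) < e"
      using \<open>e > 0\<close> by (meson le_less_trans)
  qed
qed simp

text \<open>
  Constants at distance \<open>2 \<epsilon> exp (- lam t)\<close> have images at distance at least \<open>2 \<epsilon>\<close> at time \<open>t\<close>, and about
  \<open>exp (lam t) / (2 \<epsilon>)\<close> of them fit into \<open>[0, 1]\<close>.
\<close>

lemma spanning_rate_const_ge:
  assumes "\<epsilon> > 0"
  shows "ereal lam \<le> spanning_rate (lax_oleinik L) (const_bcontfun ` {0..1}) \<epsilon>"
proof -
  have "((\<lambda>t. 1 / t * (lam * t - ln (2 * \<epsilon>))) \<longlongrightarrow> lam) at_top"
    using lam assms by real_asymp
  then have "((\<lambda>t. ereal (1 / t * (lam * t - ln (2 * \<epsilon>)))) \<longlongrightarrow> ereal lam) at_top" by simp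
  then have "ereal lam = Limsup at_top (\<lambda>t. ereal (1 / t * (lam * t - ln (2 * \<epsilon>))))"
    by (intro lim_imp_Limsup[symmetric]) auto
  also have "\<dots> \<le> spanning_rate (lax_oleinik L) (const_bcontfun ` {0..1}) \<epsilon>"
    unfolding spanning_rate_def
  proof (rule Limsup_mono)
    show "\<forall>\<^sub>F t in at_top. ereal (1 / t * (lam * t - ln (2 * \<epsilon>)))
        \<le> ereal (1 / t) * ln_enat (spanning_number (lax_oleinik L) t \<epsilon> (const_bcontfun ` {0..1}))"
      using eventually_gt_at_top[of 0]
    proof eventually_elim
      case (elim t)
      \<comment> \<open>\<open>J + 1\<close> equally spaced constants in \<open>[0, 1]\<close>.\<close>
      define J where "J = nat \<lfloor>exp (lam * t) / (2 * \<epsilon>)\<rfloor>"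
      define g where "g j = 2 * \<epsilon> * exp (- (lam * t)) * real j" for j :: nat
      define S where "S = (\<lambda>j. const_bcontfun (g j) :: 'n torus \<Rightarrow>\<^sub>C real) ` {..J}"
      have gd: "exp (lam * t) * \<bar>g i - g j\<bar> = 2 * \<epsilon> * \<bar>real i - real j\<bar>" for i j
      proof -
        have "g i - g j = 2 * \<epsilon> * exp (- (lam * t)) * (real i - real j)"
          by (simp add: g_def right_diff_distrib)
        then have "\<bar>g i - g j\<bar> = 2 * \<epsilon> * exp (- (lam * t)) * \<bar>real i - real j\<bar>"
          using assms by (simp add: abs_mult)
        moreover have "exp (lam * t) * exp (- (lam * t)) = 1" by (simp add: exp_add[symmetric])
        ultimately show ?thesis by (simp add: mult.assoc mult.left_commute)
      qed
      have inj: "inj_on (\<lambda>j. const_bcontfun (g j) :: 'n torus \<Rightarrow>\<^sub>C real) {..J}"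
      proof (rule inj_onI)
        fix i j assume "const_bcontfun (g i) = (const_bcontfun (g j) :: 'n torus \<Rightarrow>\<^sub>C real)"
        then have "apply_bcontfun (const_bcontfun (g i) :: 'n torus \<Rightarrow>\<^sub>C real) undefined = apply_bcontfun (const_bcontfun (g j)) undefined"
          by simp
        then have "g i = g j" by (simp add: const_bcontfun.rep_eq)
        then show "i = j" using assms by (simp add: g_def)
      qed
      have sub: "S \<subseteq> const_bcontfun ` {0..1}"
      proof -
        have "g j \<in> {0..1}" if "j \<le> J" for j
        proof -
          have "real j \<le> real J" using that by simp
          also have "\<dots> \<le> exp (lam * t) / (2 * \<epsilon>)" using assms by (simp add: J_def)
          finally have "g j \<le> 2 * \<epsilon> * exp (- (lam * t)) * (exp (lam * t) / (2 * \<epsilon>))"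
            unfolding g_def using assms by (intro mult_left_mono) auto
          also have "\<dots> = 1" using assms by (simp add: exp_minus field_simps)
          finally show ?thesis using assms by (simp add: g_def)
        qed
        then show ?thesis by (auto simp: S_def)
      qed
      have "enat (card S) \<le> spanning_number (lax_oleinik L) t \<epsilon> (const_bcontfun ` {0..1})"
      proof (rule card_separated_le_spanning_number[OF _ sub])
        show "finite S" by (simp add: S_def)
        fix \<phi> \<psi> assume *: "\<phi> \<in> S" "\<psi> \<in> S" "\<phi> \<noteq> \<psi>"
        then obtain i j where ij: "\<phi> = const_bcontfun (g i)" "\<psi> = const_bcontfun (g j)" "i \<noteq> j"
          by (auto simp: S_def)
        have "1 \<le> \<bar>real i - real j\<bar>" using ij(3) by linarith
        then have "2 * \<epsilon> \<le> 2 * \<epsilon> * \<bar>real i - real j\<bar>" using assms by simp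
        also have "\<dots> \<le> dist (lax_oleinik L t \<phi>) (lax_oleinik L t \<psi>)"
          using lax_oleinik_const_separation[OF elim, of "g i" "g j"] unfolding gd ij .
        finally show "\<exists>s\<in>{0..t}. 2 * \<epsilon> \<le> dist (lax_oleinik L s \<phi>) (lax_oleinik L s \<psi>)"
          using elim by (intro bexI[of _ t]) auto
      qed
      moreover have "card S = Suc J" unfolding S_def card_image[OF inj] by simp
      ultimately have "ln_enat (enat (Suc J)) \<le> ln_enat (spanning_number (lax_oleinik L) t \<epsilon> (const_bcontfun ` {0..1}))"
        by (intro ln_enat_mono) simp
      moreover have "lam * t - ln (2 * \<epsilon>) \<le> ln (real (Suc J))"
      proof -
        have "exp (lam * t) / (2 * \<epsilon>) \<le> real (Suc J)" unfolding J_def by linarith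
        then have "ln (exp (lam * t) / (2 * \<epsilon>)) \<le> ln (real (Suc J))"
          using assms by (subst ln_le_cancel_iff) auto
        then show ?thesis using assms by (simp add: ln_div)
      qed
      ultimately have "ereal (lam * t - ln (2 * \<epsilon>)) \<le> ln_enat (spanning_number (lax_oleinik L) t \<epsilon> (const_bcontfun ` {0..1}))"
        by (simp del: of_nat_Suc) (meson ereal_less_eq(3) order_trans)
      then have "ereal (1 / t) * ereal (lam * t - ln (2 * \<epsilon>)) \<le> ereal (1 / t) * ln_enat (spanning_number (lax_oleinik L) t \<epsilon> (const_bcontfun ` {0..1}))"
        using elim by (intro ereal_mult_left_mono) auto
      then show ?case by simp
    qed
  qed
  finally show ?thesis .
qed

end

theorem theorem3p2:
  fixes l :: "real ^ 'n::finite \<Rightarrow> real" and lam :: real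
    and L :: "'n torus \<Rightarrow> real ^ 'n \<Rightarrow> real \<Rightarrow> real"
  assumes "lam > 0"
    and "tonelli l"
    and "\<And>x v u. L x v u = l v + lam * u"
  shows "(\<forall>V :: ('n torus \<Rightarrow>\<^sub>C real) set. compact V \<longrightarrow>
            compact_entropy (lax_oleinik L) V \<le> ereal lam) \<and>
         topological_entropy (lax_oleinik L) = ereal lam"
proof -
  obtain c where c: "\<And>v. norm v \<le> l v + c" "continuous_on UNIV l"
    using tonelli_normalization[OF assms(2)] by blast
  interpret contact_lagrangian l lam c L
    by unfold_locales (use assms c in auto)
  have upper: "compact_entropy (lax_oleinik L) V \<le> ereal lam"
    if "compact V" for V :: "('n torus \<Rightarrow>\<^sub>C real) set"
    unfolding compact_entropy_eq_SUP by (rule SUP_least) (simp add: spanning_rate_le that)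
  let ?V = "const_bcontfun ` {0..1} :: ('n torus \<Rightarrow>\<^sub>C real) set"
  have "ereal lam \<le> spanning_rate (lax_oleinik L) ?V 1"
    by (rule spanning_rate_const_ge) simp
  also have "\<dots> \<le> compact_entropy (lax_oleinik L) ?V"
    unfolding compact_entropy_eq_SUP by (rule SUP_upper) simp
  also have "\<dots> \<le> topological_entropy (lax_oleinik L)"
    unfolding topological_entropy_def by (rule SUP_upper) (simp add: compact_const_interval)
  finally have "ereal lam \<le> topological_entropy (lax_oleinik L)" .
  moreover have "topological_entropy (lax_oleinik L) \<le> ereal lam"
    unfolding topological_entropy_def by (rule SUP_least) (use upper in simp)
  ultimately show ?thesis using upper by (auto intro: antisym)
qed

end
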